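(* Let $\mathcal{H}=\mathbb{R}^d$ with Lebesgue measure $\pi$, where each $h\in\mathbb{R}^d$ is also regarded as a measurable function $h:\mathcal{X}\to[0,1]$ (jointly measurable in $(h,x)$). Let $A:\mathcal{X}^n\to\mathbb{R}^d$ be measurable with hypothesis sensitivity coefficient $c_A$, and let $Q$ have Hamiltonian $H(h,\mathbf{x})=-\|h-A(\mathbf{x})\|^2/(2\sigma^2)$, i.e. $Q_{\mathbf{x}}=\mathcal{N}(A(\mathbf{x}),\sigma^2 I)$, where $\sigma>0$ satisfies $12nc_A^2\le\sigma^2$. Let $\mathcal{V}(A)=\mathbb{E}\left[\|A(\mathbf{X})-\mathbb{E}[A(\mathbf{X}')]\|^2\right]$ and $\delta>0$. Then: (i) If $n>8$, $\ln\mathbb{E}_{\mathbf{X}}\left[\mathbb{E}_{h\sim Q_{\mathbf{X}}}\left[e^{(n/2)\,kl(\hat L(h,\mathbf{X}),L(h))}\right]\right]\le \frac{3}{\sigma^2}\mathcal{V}(A)+\frac12\ln(2\sqrt n)$. (ii) If $n>8$, with probability at least $1-\delta$ as $\mathbf{X}\sim\mu^n$, $$\mathbb{E}_{h\sim Q_{\mathbf{X}}}\left[kl(\hat L(h,\mathbf{X}),L(h))\right]\le\frac{\frac{6}{\sigma^2}\mathcal{V}(A)+\ln(2\sqrt n)+2\ln(1/\delta)}{n}.$$ (iii) With probability at least $1-\delta$ as $\mathbf{X}\sim\mu^n$ and $h\sim Q_{\mathbf{X}}$, $\Delta(h,\mathbf{X})\le\sqrt{\frac{(3/\sigma^2)\mathcal{V}(A)+\ln(1/\delta)}{n}}$.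 (iv) With $v(h)=\mathbb{E}[(h(X)-\mathbb{E}[h(X')])^2]$, with probability at least $1-\delta$ as $\mathbf{X}\sim\mu^n$ and $h\sim Q_{\mathbf{X}}$, $$\Delta(h,\mathbf{X})\le 2\sqrt{v(h)\frac{(3/\sigma^2)\mathcal{V}(A)+\ln(1/\delta)}{n}}+\frac{(3/\sigma^2)\mathcal{V}(A)+\ln(1/\delta)}{n}.$$
   Context: $\mathcal{X}$ is a measurable space with probability measure $\mu$, $\mathbf{X}=(X_1,\dots,X_n)\sim\mu^n$, $\mathbf{X}'$ an independent copy, $X,X'\sim\mu$ independent. $\|\cdot\|$ is the Euclidean norm. The hypothesis sensitivity coefficient of $A$ is $c_A=\max_{k\in[n]}\sup_{\mathbf{x}\in\mathcal{X}^n,\,y,y'\in\mathcal{X}}\|A(S^k_y\mathbf{x})-A(S^k_{y'}\mathbf{x})\|$, where $S^k_y\mathbf{x}$ replaces the $k$-th coordinate of $\mathbf{x}$ by $y$. Expected loss $L(h)=\mathbb{E}[h(X)]$, empirical loss $\hat L(h,\mathbf{x})=\frac1n\sum_{i=1}^n h(x_i)$, generalization gap $\Delta(h,\mathbf{x})=L(h)-\hat L(h,\mathbf{x})$. For $s,t\in[0,1]$, $kl(s,t)=s\ln\frac{s}{t}+(1-s)\ln\frac{1-s}{1-t}$ (relative entropy of Bernoulli laws). Probability "as $\mathbf{X}\sim\mu^n$ and $h\sim Q_{\mathbf{X}}$" is w.r.t. the joint law. *)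

theory Defs
  imports "HOL-Probability.Probability"
begin

abbreviation sample_space :: "'x measure \<Rightarrow> nat \<Rightarrow> (nat \<Rightarrow> 'x) measure" where
  "sample_space M n \<equiv> PiM {..<n} (\<lambda>_. M)"

definition hyp_sens :: "'x measure \<Rightarrow> nat \<Rightarrow> ((nat \<Rightarrow> 'x) \<Rightarrow> 'h::real_normed_vector) \<Rightarrow> ereal" where
  "hyp_sens M n A = (SUP k\<in>{..<n}. SUP x\<in>space (sample_space M n). SUP y\<in>space M. SUP y'\<in>space M.
      ereal (norm (A (x(k := y)) - A (x(k := y')))))"

text \<open>Expected loss and empirical loss; f h is the function X -> [0,1] associated with h.\<close>
definition exp_loss :: "'x measure \<Rightarrow> ('h \<Rightarrow> 'x \<Rightarrow> real) \<Rightarrow> 'h \<Rightarrow> real" where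
  "exp_loss M f h = (\<integral>x. f h x \<partial>M)"

definition emp_loss :: "nat \<Rightarrow> ('h \<Rightarrow> 'x \<Rightarrow> real) \<Rightarrow> 'h \<Rightarrow> (nat \<Rightarrow> 'x) \<Rightarrow> real" where
  "emp_loss n f h xs = (\<Sum>i<n. f h (xs i)) / real n"

definition gen_gap :: "'x measure \<Rightarrow> nat \<Rightarrow> ('h \<Rightarrow> 'x \<Rightarrow> real) \<Rightarrow> 'h \<Rightarrow> (nat \<Rightarrow> 'x) \<Rightarrow> real" where
  "gen_gap M n f h xs = exp_loss M f h - emp_loss n f h xs"

text \<open>Relative entropy of Bernoulli laws, with the usual conventions 0 ln 0 = 0
  and a ln(a/0) = +infinity for a > 0.\<close>
definition kl :: "real \<Rightarrow> real \<Rightarrow> ereal" where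
  "kl s t = (if (t = 0 \<and> s > 0) \<or> (t = 1 \<and> s < 1) then \<infinity>
             else ereal ((if s = 0 then 0 else s * ln (s / t))
                       + (if s = 1 then 0 else (1 - s) * ln ((1 - s) / (1 - t)))))"

definition eexp :: "ereal \<Rightarrow> ennreal" where
  "eexp z = (if z = \<infinity> then \<infinity> else if z = -\<infinity> then 0 else ennreal (exp (real_of_ereal z)))"

definition gibbs :: "('h::euclidean_space \<Rightarrow> 'z \<Rightarrow> real) \<Rightarrow> 'z \<Rightarrow> 'h measure" where
  "gibbs H xs = density lborel (\<lambda>h. ennreal (exp (H h xs) / (\<integral>g. exp (H g xs) \<partial>lborel)))"

definition var_alg :: "'x measure \<Rightarrow> nat \<Rightarrow> ((nat \<Rightarrow> 'x) \<Rightarrow> 'h::euclidean_space) \<Rightarrow> real" where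
  "var_alg M n A = (\<integral>xs. (norm (A xs - (\<integral>ys. A ys \<partial>sample_space M n)))\<^sup>2 \<partial>sample_space M n)"

definition var_h :: "'x measure \<Rightarrow> ('h \<Rightarrow> 'x \<Rightarrow> real) \<Rightarrow> 'h \<Rightarrow> real" where
  "var_h M f h = (\<integral>x. (f h x - exp_loss M f h)\<^sup>2 \<partial>M)"

end

theory Submission
  imports Defs
begin

text \<open>
  Let \<open>q\<close> be the density of \<open>Q\<close> and \<open>g\<close> the Gaussian density centred at the mean of \<open>A\<close>.
  Writing \<open>e\<^sup>F q = (e\<^sup>F \<surd>g) (q / \<surd>g)\<close> and applying Cauchy-Schwarz to the product of Lebesgue measure and
  the sample law bounds the joint exponential moment of \<open>F\<close> by the square root of
  \<open>sup\<^sub>h E e\<^bsup>2F(h,X)\<^esup>\<close> times \<open>\<integral>\<integral> q\<^sup>2 / g\<close>; completing the square, the latter is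
  \<open>E exp (\<parallel>A X - E A\<parallel>\<^sup>2 / \<sigma>\<^sup>2)\<close>, independently of the dimension. This moment is at most
  \<open>exp (3 V / \<sigma>\<^sup>2)\<close>, by integrating out one coordinate at a time.

  It remains to bound \<open>E e\<^bsup>2F(h,X)\<^esup>\<close> for fixed \<open>h\<close>, by Hoeffding's lemma, a Bernstein bound, or Maurer's
  bound \<open>2 \<surd>n\<close> on the exponential moment of \<open>n kl\<close>. For the last one, convexity reduces the losses to
  Bernoulli variables, Abel's identity turns the resulting binomial sum into
  \<open>\<Sum>k. \<Prod>j<k. (1 - j / n)\<close>, and that sum is estimated through its first moment, which telescopes.
\<close>

section \<open>Abel's identity and the binomial entropy sum\<close>

text \<open>The obstacle is that h is drawn from a law that depends on the sample, so moment bounds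
  for a fixed h do not apply directly. The reference density g is free of the sample; under it the
  sample can be integrated first, with h held fixed. Cauchy-Schwarz separates the two laws at the
  price of doubling F: it is n kl that has a controlled exponential moment, hence n/2 in front of kl
  in (i), and the square root gives the 1/2 in front of ln (2 sqrt n). Since h is fixed in the
  moment bound, F may carry parameters that depend on h; (iv) uses this to adapt to the variance of
  h. Markov's inequality acts on the joint law in (iii) and (iv), but on the sample alone in (ii),
  where h is averaged through a tangent line of exp. The constants 12 and 3: the exponent
  1/\<sigma>^2 grows by a factor 1 + 1/n for each of the n coordinates, so at most by e <= 3 in
  total; a single coordinate costs no more than this factor if 4 (3/\<sigma>^2) c^2 <= 1/n, that is,
  12 n c^2 <= \<sigma>^2.\<close>

lemma finite_difference_power:
  fixes x :: real
  assumes "m \<le> n"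
  shows "(\<Sum>k\<le>n. real (n choose k) * (-1) ^ (n - k) * (x + real k) ^ m) = (if m = n then fact n else 0)"
  using assms
proof (induction n arbitrary: x m)
  case 0
  then show ?case by simp
next
  case (Suc n)
  show ?case using Suc.prems
  proof (induction m)
    case 0
    have "(\<Sum>k\<le>Suc n. real (Suc n choose k) * (-1) ^ (Suc n - k)) = (1 + (-1::real)) ^ Suc n"
      by (subst binomial_ring) simp
    then show ?case by simp
  next
    case (Suc m)
    note outer_IH = \<open>\<And>x m. m \<le> n \<Longrightarrow> (\<Sum>k\<le>n. real (n choose k) * (-1) ^ (n - k) * (x + real k) ^ m) = (if m = n then fact n else 0)\<close>
    \<comment> \<open>One factor x + k is split. The x part has a lower power; in the k part, k is
      absorbed into the binomial coefficient, which leaves a difference of order n at x + 1.\<close>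
    have "(\<Sum>k\<le>Suc n. real (Suc n choose k) * (-1) ^ (Suc n - k) * (x + real k) ^ Suc m)
        = x * (\<Sum>k\<le>Suc n. real (Suc n choose k) * (-1) ^ (Suc n - k) * (x + real k) ^ m)
          + (\<Sum>k\<le>Suc n. real k * real (Suc n choose k) * (-1) ^ (Suc n - k) * (x + real k) ^ m)"
      by (simp add: sum_distrib_left sum.distrib [symmetric] algebra_simps del: sum.atMost_Suc)
    also have "(\<Sum>k\<le>Suc n. real k * real (Suc n choose k) * (-1) ^ (Suc n - k) * (x + real k) ^ m)
        = (\<Sum>k\<le>n. real (Suc k * (Suc n choose Suc k)) * (-1) ^ (n - k) * ((x + 1) + real k) ^ m)"
      by (subst sum.atMost_Suc_shift) (simp add: algebra_simps del: binomial_Suc_Suc)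
    also have "\<dots> = real (Suc n) * (\<Sum>k\<le>n. real (n choose k) * (-1) ^ (n - k) * ((x + 1) + real k) ^ m)"
      unfolding Suc_times_binomial of_nat_mult by (simp only: sum_distrib_left mult.assoc)
    finally show ?case
      using Suc.IH Suc.prems outer_IH[of m "x + 1"]
      by (auto simp del: sum.atMost_Suc)
  qed
qed

text \<open>Both sides have the same derivative in \<open>y\<close> and agree at \<open>y = - x - n\<close>, where the left-hand
  side is an \<open>n\<close>-th finite difference of an \<open>n\<close>-th power.\<close>

lemma Abel_identity:
  fixes x y :: real
  shows "(\<Sum>k\<le>n. real (n choose k) * (x + real k) ^ k * (y + real (n - k)) ^ (n - k))
    = (\<Sum>k\<le>n. real (n choose k) * fact (n - k) * (x + y + real n) ^ k)"
proof (induction n arbitrary: x y)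
  case 0
  then show ?case by simp
next
  case (Suc n)
  define D where "D = (\<lambda>y. (\<Sum>k\<le>Suc n. real (Suc n choose k) * (x + real k) ^ k * (y + real (Suc n - k)) ^ (Suc n - k))
    - (\<Sum>k\<le>Suc n. real (Suc n choose k) * fact (Suc n - k) * (x + y + real (Suc n)) ^ k))"
  have "(D has_real_derivative 0) (at y)" for y
  proof -
    \<comment> \<open>Each derivative is n + 1 times the corresponding side of the identity of order
      n at (x, y + 1), so the induction hypothesis makes them cancel.\<close>
    have "(D has_real_derivative
       (\<Sum>k\<le>Suc n. real (Suc n choose k) * (x + real k) ^ k * (real (Suc n - k) * (y + real (Suc n - k)) ^ (Suc n - k - 1)))
     - (\<Sum>k\<le>Suc n. real (Suc n choose k) * fact (Suc n - k) * (real k * (x + y + real (Suc n)) ^ (k - 1)))) (at y)"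
      unfolding D_def
      by (intro DERIV_diff DERIV_sum DERIV_cmult) (auto intro!: derivative_eq_intros)
    also have "(\<Sum>k\<le>Suc n. real (Suc n choose k) * (x + real k) ^ k * (real (Suc n - k) * (y + real (Suc n - k)) ^ (Suc n - k - 1)))
      = (\<Sum>k\<le>n. real ((Suc n - k) * (Suc n choose k)) * (x + real k) ^ k * (y + 1 + real (n - k)) ^ (n - k))"
      unfolding of_nat_mult by (auto simp: Suc_diff_le of_nat_diff add_ac mult_ac add_diff_eq simp del: binomial_Suc_Suc intro!: sum.cong)
    also have "\<dots> = (\<Sum>k\<le>n. real (Suc n * (n choose k)) * (x + real k) ^ k * (y + 1 + real (n - k)) ^ (n - k))"
      by (intro sum.cong refl) (use binomial_absorb_comp[of "Suc n"] in simp)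
    also have "\<dots> = real (Suc n) * (\<Sum>k\<le>n. real (n choose k) * (x + real k) ^ k * (y + 1 + real (n - k)) ^ (n - k))"
      unfolding of_nat_mult by (simp only: sum_distrib_left mult.assoc)
    also have "\<dots> = real (Suc n) * (\<Sum>k\<le>n. real (n choose k) * fact (n - k) * (x + (y + 1) + real n) ^ k)"
      by (subst Suc.IH) simp
    also have "\<dots> = (\<Sum>k\<le>n. real (Suc n * (n choose k)) * fact (n - k) * (x + y + real (Suc n)) ^ k)"
      unfolding of_nat_mult by (simp add: sum_distrib_left mult.assoc add_ac)
    also have "(\<Sum>k\<le>Suc n. real (Suc n choose k) * fact (Suc n - k) * (real k * (x + y + real (Suc n)) ^ (k - 1)))
      = (\<Sum>k\<le>n. real (Suc k * (Suc n choose Suc k)) * fact (n - k) * (x + y + real (Suc n)) ^ k)"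
      by (subst sum.atMost_Suc_shift) (simp add: algebra_simps del: binomial_Suc_Suc)
    finally show ?thesis unfolding Suc_times_binomial by simp
  qed
  then have "D y = D (- x - real (Suc n))"
    by (intro DERIV_isconst_all) auto
  also have "D (- x - real (Suc n)) = 0"
  proof -
    have "(\<Sum>k\<le>Suc n. real (Suc n choose k) * (x + real k) ^ k * (- x - real (Suc n) + real (Suc n - k)) ^ (Suc n - k))
      = (\<Sum>k\<le>Suc n. real (Suc n choose k) * (-1) ^ (Suc n - k) * (x + real k) ^ Suc n)"
    proof (intro sum.cong refl)
      fix k assume k: "k \<in> {..Suc n}"
      then have "- x - real (Suc n) + real (Suc n - k) = (-1) * (x + real k)"
        by (auto simp: of_nat_diff)
      moreover have "(x + real k) ^ Suc n = (x + real k) ^ k * (x + real k) ^ (Suc n - k)"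
        using k by (simp flip: power_add)
      ultimately show "real (Suc n choose k) * (x + real k) ^ k * (- x - real (Suc n) + real (Suc n - k)) ^ (Suc n - k)
        = real (Suc n choose k) * (-1) ^ (Suc n - k) * (x + real k) ^ Suc n"
        by (simp only: power_mult_distrib) simp
    qed
    also have "\<dots> = fact (Suc n)"
      by (subst finite_difference_power) auto
    \<comment> \<open>The base x + y + (n + 1) is 0 at this y, so only k = 0 survives.\<close>
    moreover have "(\<Sum>k\<le>Suc n. real (Suc n choose k) * fact (Suc n - k) * (x + (- x - real (Suc n)) + real (Suc n)) ^ k) = fact (Suc n)"
      by (subst sum.atMost_Suc_shift) simp
    ultimately show ?thesis unfolding D_def by simp
  qed
  finally show ?case unfolding D_def by simp
qed

text \<open>The product r_k is the probability that k uniform draws from n values are distinct. From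
  r_k - r_(k+1) = (k/n) r_k the first moment of r telescopes to n. The cut-off m is free: terms with
  k beyond m are charged to the first moment, the others also to r_k <= 1.\<close>

lemma falling_factorial_sum_le:
  assumes "n \<ge> 1" "m \<ge> 1"
  shows "(\<Sum>k\<le>n. \<Prod>j<k. (1 - real j / real n)) \<le> real n / real m + (real m + 1) / 2"
proof -
  define r where "r = (\<lambda>k. \<Prod>j<k. (1 - real j / real n))"
  have r: "0 \<le> r k" "r k \<le> 1" if "k \<le> Suc n" for k
    unfolding r_def using that assms by (auto intro!: prod_nonneg prod_le_1 simp: field_simps)
  have "(\<Sum>k\<le>n. real k * r k) = (\<Sum>k<Suc n. real n * (r k - r (Suc k)))"
    unfolding lessThan_Suc_atMost by (intro sum.cong refl) (use assms in \<open>auto simp: r_def field_simps\<close>)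
  also have "\<dots> = real n * (r 0 - r (Suc n))"
    by (simp only: sum_distrib_left [symmetric] sum_lessThan_telescope')
  \<comment> \<open>The factor with j = n makes r (n + 1) vanish.\<close>
  also have "\<dots> = real n" using assms by (simp add: r_def)
  finally have first_moment: "(\<Sum>k\<le>n. real k * r k) = real n" .
  have "(\<Sum>k\<le>n. r k) \<le> (\<Sum>k\<le>n. real k * r k / real m + max 0 (1 - real k / real m))"
  proof (intro sum_mono)
    fix k assume "k \<in> {..n}"
    then have rk: "0 \<le> r k" "r k \<le> 1" using r[of k] by auto
    have "r k * (1 - real k / real m) \<le> r k * max 0 (1 - real k / real m)"
      using rk by (intro mult_left_mono) auto
    also have "\<dots> \<le> 1 * max 0 (1 - real k / real m)"
      using rk by (intro mult_right_mono) auto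
    finally show "r k \<le> real k * r k / real m + max 0 (1 - real k / real m)"
      by (simp add: algebra_simps)
  qed
  also have "\<dots> = real n / real m + (\<Sum>k\<le>n. max 0 (1 - real k / real m))"
    by (simp add: sum.distrib first_moment flip: sum_divide_distrib)
  \<comment> \<open>Extending the range to n + m makes the sum contain all k <= m whether or not m
    exceeds n; the added terms are nonnegative.\<close>
  also have "(\<Sum>k\<le>n. max 0 (1 - real k / real m)) \<le> (\<Sum>k\<le>n+m. max 0 (1 - real k / real m))"
    by (intro sum_mono2) auto
  also have "(\<Sum>k\<le>n+m. max 0 (1 - real k / real m)) = (\<Sum>k\<le>m. 1 - real k / real m)"
    using assms by (intro sum.mono_neutral_cong_right) (auto simp: field_simps max_def)
  also have "\<dots> = (real m + 1) / 2"
  proof -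
    have "2 * (\<Sum>k\<le>m. real k) = real m * (real m + 1)"
      by (induction m) (auto simp: algebra_simps)
    then have "(\<Sum>k\<le>m. real k) = real m * (real m + 1) / 2" by simp
    then show ?thesis
      using assms by (simp add: sum_subtractf flip: sum_divide_distrib)
  qed
  finally show ?thesis by (simp add: r_def)
qed

text \<open>This is the expectation of exp (n kl (k/n, p)) for a binomial count k, from which p has
  cancelled. Multiplied by n^n it is the left side of Abel's identity at x = y = 0; reversing the
  index on the right side gives the falling products.\<close>

lemma binomial_entropy_sum_le:
  assumes "n \<ge> 3"
  shows "(\<Sum>k\<le>n. real (n choose k) * (real k / real n) ^ k * (1 - real k / real n) ^ (n - k)) \<le> 2 * sqrt (real n)"
proof -
  have "(\<Sum>k\<le>n. real (n choose k) * (real k / real n) ^ k * (1 - real k / real n) ^ (n - k))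
    = (\<Sum>k\<le>n. real (n choose k) * (0 + real k) ^ k * (0 + real (n - k)) ^ (n - k)) / real n ^ n"
    unfolding sum_divide_distrib
  proof (intro sum.cong refl)
    fix k assume k: "k \<in> {..n}"
    then have "1 - real k / real n = real (n - k) / real n"
      using assms by (auto simp: field_simps of_nat_diff)
    moreover have "real n ^ n = real n ^ k * real n ^ (n - k)"
      using k by (simp flip: power_add)
    ultimately show "real (n choose k) * (real k / real n) ^ k * (1 - real k / real n) ^ (n - k)
      = real (n choose k) * (0 + real k) ^ k * (0 + real (n - k)) ^ (n - k) / real n ^ n"
      by (simp add: power_divide)
  qed
  also have "\<dots> = (\<Sum>k\<le>n. real (n choose k) * fact (n - k) * real n ^ k) / real n ^ n"
    unfolding Abel_identity by simp
  also have "\<dots> = (\<Sum>k\<le>n. real (n choose (n - k)) * fact k * real n ^ (n - k)) / real n ^ n"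
    by (subst sum.nat_diff_reindex [symmetric, where n = "Suc n", unfolded lessThan_Suc_atMost])
       (auto intro!: sum.cong)
  also have "\<dots> = (\<Sum>k\<le>n. \<Prod>j<k. (1 - real j / real n))"
    unfolding sum_divide_distrib
  proof (intro sum.cong refl)
    fix k assume k: "k \<in> {..n}"
    have "real (n choose (n - k)) * fact k = (\<Prod>j<k. real n - real j)"
      using k by (simp add: binomial_symmetric [symmetric] binomial_gbinomial gbinomial_prod_rev atLeast0LessThan)
    also have "\<dots> = (\<Prod>j<k. real n * (1 - real j / real n))"
      using assms by (intro prod.cong) (auto simp: field_simps)
    also have "\<dots> = real n ^ k * (\<Prod>j<k. (1 - real j / real n))"
      by (simp add: prod.distrib)
    finally have "real (n choose (n - k)) * fact k * real n ^ (n - k)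
      = real n ^ k * real n ^ (n - k) * (\<Prod>j<k. (1 - real j / real n))" by simp
    also have "real n ^ k * real n ^ (n - k) = real n ^ n"
      using k by (simp flip: power_add)
    finally show "real (n choose (n - k)) * fact k * real n ^ (n - k) / real n ^ n = (\<Prod>j<k. (1 - real j / real n))"
      using assms by simp
  qed
  also have "\<dots> \<le> 2 * sqrt (real n)"
  proof -
    define s where "s = sqrt (real n)"
    have s: "s * s = real n" "s > 0" using assms by (auto simp: s_def)
    \<comment> \<open>The bound n/m + m/2 is least at m = sqrt (2 n); rounding up to an integer
      costs at most 1/2.\<close>
    define m where "m = nat \<lceil>sqrt 2 * s\<rceil>"
    have m: "sqrt 2 * s \<le> real m" "real m \<le> sqrt 2 * s + 1"
      unfolding m_def using s real_sqrt_ge_zero[of 2] by (auto simp: mult_nonneg_nonneg)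
    have "m \<ge> 1" using m s by (metis One_nat_def Suc_leI gr0I mult_pos_pos not_le of_nat_0 real_sqrt_gt_zero zero_less_numeral)
    have "(\<Sum>k\<le>n. \<Prod>j<k. (1 - real j / real n)) \<le> real n / real m + (real m + 1) / 2"
      using assms \<open>m \<ge> 1\<close> by (intro falling_factorial_sum_le) auto
    also have "\<dots> \<le> real n / (sqrt 2 * s) + (sqrt 2 * s + 2) / 2"
      using m s \<open>m \<ge> 1\<close> by (intro add_mono divide_left_mono mult_pos_pos) auto
    also have "real n / (sqrt 2 * s) = sqrt 2 * s / 2"
      using s by (simp add: field_simps)
    also have "sqrt 2 * s / 2 + (sqrt 2 * s + 2) / 2 = sqrt 2 * s + 1" by (simp add: field_simps)
    also have "\<dots> \<le> 2 * s"
    proof -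
      \<comment> \<open>The claim amounts to s >= 1 / (2 - sqrt 2) = 1.7071..., slightly below sqrt
        3. The rational bounds suffice because (2 - 99/70) (173/100) > 1.\<close>
      have "sqrt 2 \<le> 99 / 70" by (rule real_le_lsqrt) (auto simp: power2_eq_square)
      then have "sqrt 2 * s \<le> 99 / 70 * s" using s by (intro mult_right_mono) auto
      moreover have "s \<ge> 173 / 100" unfolding s_def
        by (rule real_le_rsqrt) (use assms in \<open>auto simp: power2_eq_square\<close>)
      ultimately show ?thesis by linarith
    qed
    finally show ?thesis by (simp add: s_def)
  qed
  finally show ?thesis .
qed

section \<open>The relative entropy of Bernoulli laws\<close>

text \<open>Real-valued form of \<open>kl\<close> for 0 < t < 1. At s = 0 and s = 1 the zero
  coefficient removes the logarithm of 0, so no case distinction remains.\<close>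

definition bernoulli_divergence :: "real \<Rightarrow> real \<Rightarrow> real" where
  "bernoulli_divergence s t = s * ln (s / t) + (1 - s) * ln ((1 - s) / (1 - t))"

lemma kl_eq_bernoulli_divergence:
  assumes "0 < t" "t < 1"
  shows "kl s t = ereal (bernoulli_divergence s t)"
  using assms by (auto simp: kl_def bernoulli_divergence_def)

text \<open>The inequality ln x <= x - 1 gives a ln (a/b) >= a - b; the lower bounds for the two
  summands add up to 0.\<close>

lemma bernoulli_divergence_nonneg:
  assumes "0 \<le> s" "s \<le> 1" "0 < t" "t < 1"
  shows "0 \<le> bernoulli_divergence s t"
proof -
  have *: "a * ln (a / b) \<ge> a - b" if "a \<ge> 0" "b > 0" for a b :: real
  proof (cases "a = 0")
    case False
    then have "ln (b / a) \<le> b / a - 1" using that by (intro ln_le_minus_one) auto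
    then have "a * ln (b / a) \<le> a * (b / a - 1)" using that by (intro mult_left_mono) auto
    then show ?thesis using False that by (simp add: ln_div algebra_simps)
  qed (use that in auto)
  show ?thesis
    using *[of s t] *[of "1 - s" "1 - t"] assms by (simp add: bernoulli_divergence_def)
qed

lemma kl_nonneg:
  assumes "0 \<le> s" "s \<le> 1" "0 \<le> t" "t \<le> 1"
  shows "0 \<le> kl s t"
proof (cases "0 < t \<and> t < 1")
  case True
  then show ?thesis
    using assms by (simp add: kl_eq_bernoulli_divergence bernoulli_divergence_nonneg)
qed (use assms in \<open>auto simp: kl_def\<close>)

text \<open>On the open interval, the divergence is the upper envelope of the affine functions
  \<open>a \<mapsto> a ln (s / t) + (1 - a) ln ((1 - s) / (1 - t))\<close>; this also settles the endpoints,
  where it is not differentiable.\<close>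

lemma convex_on_bernoulli_divergence:
  assumes t: "0 < t" "t < 1"
  shows "convex_on {0..1} (\<lambda>s. bernoulli_divergence s t)"
proof (rule convex_onI)
  fix u a b :: real
  assume u: "0 < u" "u < 1" and ab: "a \<in> {0..1}" "b \<in> {0..1}"
  define s where "s = (1 - u) *\<^sub>R a + u *\<^sub>R b"
  have s_eq: "s = (1 - u) * a + u * b" by (simp add: s_def)
  show "bernoulli_divergence s t
      \<le> (1 - u) * bernoulli_divergence a t + u * bernoulli_divergence b t"
  proof (cases "0 < s \<and> s < 1")
    case True
    \<comment> \<open>The right side minus the left side is \<open>bernoulli_divergence a s\<close>,
      which is nonnegative.\<close>
    have envelope: "a * ln (s / t) + (1 - a) * ln ((1 - s) / (1 - t)) \<le> bernoulli_divergence a t"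
      if "a \<in> {0..1}" for a
      using bernoulli_divergence_nonneg[of a s] True that t
      by (cases "a = 0"; cases "a = 1") (auto simp: bernoulli_divergence_def ln_div algebra_simps)
    have "bernoulli_divergence s t
        = (1 - u) * (a * ln (s / t) + (1 - a) * ln ((1 - s) / (1 - t)))
          + u * (b * ln (s / t) + (1 - b) * ln ((1 - s) / (1 - t)))"
      unfolding bernoulli_divergence_def by (subst (1 3) s_eq) (simp add: algebra_simps)
    also have "\<dots> \<le> (1 - u) * bernoulli_divergence a t + u * bernoulli_divergence b t"
      using u ab by (intro add_mono mult_left_mono envelope) auto
    finally show ?thesis .
  next
    case False
    have "0 \<le> s" "s \<le> 1"
      using ab u convex_bound_le[of a 1 b "1 - u" u] by (auto simp: s_eq)
    \<comment> \<open>Endpoints are extreme points of [0,1]: a proper convex combination reaches one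
      only if a and b both equal it.\<close>
    with False consider "s = 0" | "s = 1" by fastforce
    then have "a = s \<and> b = s"
    proof cases
      case 1
      with ab u have "(1 - u) * a = 0" "u * b = 0"
        by (smt (verit) atLeastAtMost_iff mult_nonneg_nonneg s_eq)+
      with 1 u show ?thesis by auto
    next
      case 2
      then have "(1 - u) * (1 - a) + u * (1 - b) = 0" by (simp add: s_eq algebra_simps)
      moreover have "(1 - u) * (1 - a) \<ge> 0" "u * (1 - b) \<ge> 0" using ab u by auto
      ultimately have "(1 - u) * (1 - a) = 0" "u * (1 - b) = 0" by linarith+
      with 2 u show ?thesis by auto
    qed
    then show ?thesis by (simp add: algebra_simps)
  qed
qed auto

lemma convex_on_exp_bernoulli_divergence:
  assumes t: "0 < t" "t < 1" and n: "n > 0"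
  shows "convex_on {0..n} (\<lambda>c. exp (n * bernoulli_divergence (c / n) t))"
proof (rule convex_onI)
  fix u a b :: real
  assume u: "0 < u" "u < 1" and ab: "a \<in> {0..n}" "b \<in> {0..n}"
  have "((1 - u) *\<^sub>R a + u *\<^sub>R b) / n = (1 - u) *\<^sub>R (a / n) + u *\<^sub>R (b / n)"
    by (simp add: add_divide_distrib)
  then have "bernoulli_divergence (((1 - u) *\<^sub>R a + u *\<^sub>R b) / n) t
      \<le> (1 - u) * bernoulli_divergence (a / n) t + u * bernoulli_divergence (b / n) t"
    using u ab n convex_onD[OF convex_on_bernoulli_divergence[OF t], of u "a / n" "b / n"] by auto
  then have "exp (n * bernoulli_divergence (((1 - u) *\<^sub>R a + u *\<^sub>R b) / n) t)
      \<le> exp (n * ((1 - u) * bernoulli_divergence (a / n) t + u * bernoulli_divergence (b / n) t))"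
    using n by auto
  also have "\<dots> \<le> (1 - u) * exp (n * bernoulli_divergence (a / n) t) + u * exp (n * bernoulli_divergence (b / n) t)"
    using convex_onD[OF convex_on_exp[of n], of u "bernoulli_divergence (a / n) t" "bernoulli_divergence (b / n) t"] u n
    by auto
  finally show "exp (n * bernoulli_divergence (((1 - u) *\<^sub>R a + u *\<^sub>R b) / n) t)
    \<le> (1 - u) * exp (n * bernoulli_divergence (a / n) t) + u * exp (n * bernoulli_divergence (b / n) t)" .
qed auto

text \<open>Pascal's rule. For p in [0,1] it conditions a binomial count on one trial: failure keeps
  the offset c, success raises it by 1.\<close>

lemma binomial_average_Suc:
  fixes p :: real and \<psi> :: "real \<Rightarrow> real"
  shows "(\<Sum>k\<le>Suc m. real (Suc m choose k) * p ^ k * (1 - p) ^ (Suc m - k) * \<psi> (c + real k))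
    = (1 - p) * (\<Sum>k\<le>m. real (m choose k) * p ^ k * (1 - p) ^ (m - k) * \<psi> (c + real k))
      + p * (\<Sum>k\<le>m. real (m choose k) * p ^ k * (1 - p) ^ (m - k) * \<psi> (c + 1 + real k))"
proof -
  have "(\<Sum>k\<le>Suc m. real (Suc m choose k) * p ^ k * (1 - p) ^ (Suc m - k) * \<psi> (c + real k))
    = (1 - p) ^ Suc m * \<psi> c + (\<Sum>k\<le>m. real (m choose Suc k) * p ^ Suc k * (1 - p) ^ (m - k) * \<psi> (c + real (Suc k)))
      + (\<Sum>k\<le>m. real (m choose k) * p ^ Suc k * (1 - p) ^ (m - k) * \<psi> (c + 1 + real k))"
    by (subst sum.atMost_Suc_shift) (simp add: sum.distrib algebra_simps)
  also have "(1 - p) ^ Suc m * \<psi> c + (\<Sum>k\<le>m. real (m choose Suc k) * p ^ Suc k * (1 - p) ^ (m - k) * \<psi> (c + real (Suc k)))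
    = (\<Sum>k\<le>Suc m. real (m choose k) * p ^ k * (1 - p) ^ (Suc m - k) * \<psi> (c + real k))"
    by (subst sum.atMost_Suc_shift) simp
  also have "\<dots> = (1 - p) * (\<Sum>k\<le>m. real (m choose k) * p ^ k * (1 - p) ^ (m - k) * \<psi> (c + real k))"
    by (simp add: sum_distrib_left Suc_diff_le mult_ac)
  also have "(\<Sum>k\<le>m. real (m choose k) * p ^ Suc k * (1 - p) ^ (m - k) * \<psi> (c + 1 + real k))
    = p * (\<Sum>k\<le>m. real (m choose k) * p ^ k * (1 - p) ^ (m - k) * \<psi> (c + 1 + real k))"
    by (simp add: sum_distrib_left mult_ac)
  finally show ?thesis .
qed

text \<open>On [a, a + 1] a convex function lies below its chord, so replacing a [0,1]-valued
  variable by a Bernoulli variable of the same mean can only raise the expectation. The offset c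
  absorbs the outcomes of coordinates already replaced, and N delimits the interval of
  convexity.\<close>

lemma (in prob_space) nn_integral_convex_sum_le_binomial:
  fixes g :: "'a \<Rightarrow> real" and \<psi> :: "real \<Rightarrow> real" and N c :: real
  assumes g [measurable]: "g \<in> borel_measurable M"
    and g_range: "\<And>x. x \<in> space M \<Longrightarrow> 0 \<le> g x \<and> g x \<le> 1"
    and \<psi> [measurable]: "\<psi> \<in> borel_measurable borel"
    and \<psi>_nonneg: "\<And>c. 0 \<le> \<psi> c"
    and convex: "convex_on {0..N} \<psi>"
    and I: "finite I" and c: "0 \<le> c" "c + real (card I) \<le> N"
  defines "p \<equiv> expectation g"
  shows "(\<integral>\<^sup>+ xs. \<psi> (c + (\<Sum>i\<in>I. g (xs i))) \<partial>PiM I (\<lambda>_. M))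
    \<le> (\<Sum>k\<le>card I. real (card I choose k) * p ^ k * (1 - p) ^ (card I - k) * \<psi> (c + real k))"
  using I c
proof (induction I arbitrary: c rule: finite_induct)
  case empty
  then show ?case
    by (simp add: PiM_empty nn_integral_count_space_finite)
next
  case (insert j I)
  interpret product_sigma_finite "\<lambda>_. M" by (intro product_sigma_finite.intro sigma_finite_measure_axioms)
  have int_g: "integrable M g"
    using g_range by (intro integrable_const_bound[where B = 1]) auto
  have p: "0 \<le> p" "p \<le> 1"
    using g_range int_g by (auto simp: p_def intro!: integral_nonneg_AE integral_le_const)
  have one_coordinate: "(\<integral>\<^sup>+ y. \<psi> (a + g y) \<partial>M) \<le> (1 - p) * \<psi> a + p * \<psi> (a + 1)"
    if a: "0 \<le> a" "a + 1 \<le> N" for a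
  proof -
    have "(\<integral>\<^sup>+ y. \<psi> (a + g y) \<partial>M) \<le> (\<integral>\<^sup>+ y. ennreal ((1 - g y) * \<psi> a + g y * \<psi> (a + 1)) \<partial>M)"
    proof (intro nn_integral_mono ennreal_leI)
      fix y assume "y \<in> space M"
      then show "\<psi> (a + g y) \<le> (1 - g y) * \<psi> a + g y * \<psi> (a + 1)"
        using convex_onD[OF convex, of "g y" a "a + 1"] g_range[of y] a by (simp add: algebra_simps)
    qed
    also have "\<dots> = ennreal (\<integral>y. (1 - g y) * \<psi> a + g y * \<psi> (a + 1) \<partial>M)"
      using g_range \<psi>_nonneg int_g by (intro nn_integral_eq_integral) (auto intro!: AE_I2)
    also have "(\<integral>y. (1 - g y) * \<psi> a + g y * \<psi> (a + 1) \<partial>M) = (1 - p) * \<psi> a + p * \<psi> (a + 1)"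
      using int_g by (simp add: p_def prob_space)
    finally show ?thesis .
  qed
  have "(\<integral>\<^sup>+ xs. \<psi> (c + (\<Sum>i\<in>insert j I. g (xs i))) \<partial>PiM (insert j I) (\<lambda>_. M))
    = (\<integral>\<^sup>+ xs. (\<integral>\<^sup>+ y. \<psi> (c + (\<Sum>i\<in>insert j I. g ((xs(j := y)) i))) \<partial>M) \<partial>PiM I (\<lambda>_. M))"
    using insert.hyps by (intro product_nn_integral_insert) (auto intro!: measurable_compose[OF _ \<psi>])
  also have "\<dots> = (\<integral>\<^sup>+ xs. (\<integral>\<^sup>+ y. \<psi> ((c + (\<Sum>i\<in>I. g (xs i))) + g y) \<partial>M) \<partial>PiM I (\<lambda>_. M))"
  proof (intro nn_integral_cong)
    fix xs y
    have "(\<Sum>i\<in>I. g ((xs(j := y)) i)) = (\<Sum>i\<in>I. g (xs i))"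
      using insert.hyps by (intro sum.cong) auto
    then show "ennreal (\<psi> (c + (\<Sum>i\<in>insert j I. g ((xs(j := y)) i)))) = ennreal (\<psi> ((c + (\<Sum>i\<in>I. g (xs i))) + g y))"
      using insert.hyps by (simp add: add_ac)
  qed
  also have "\<dots> \<le> (\<integral>\<^sup>+ xs. ennreal ((1 - p) * \<psi> (c + (\<Sum>i\<in>I. g (xs i))) + p * \<psi> (c + (\<Sum>i\<in>I. g (xs i)) + 1)) \<partial>PiM I (\<lambda>_. M))"
  proof (intro nn_integral_mono one_coordinate)
    fix xs assume "xs \<in> space (PiM I (\<lambda>_. M))"
    then have xs: "xs i \<in> space M" if "i \<in> I" for i using that by (auto simp: space_PiM)
    show "0 \<le> c + (\<Sum>i\<in>I. g (xs i))"
      using insert.prems g_range xs by (auto intro!: add_nonneg_nonneg sum_nonneg)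
    have "(\<Sum>i\<in>I. g (xs i)) \<le> real (card I)"
      using g_range xs sum_bounded_above[of I "\<lambda>i. g (xs i)" 1] by auto
    then show "c + (\<Sum>i\<in>I. g (xs i)) + 1 \<le> N"
      using insert.prems insert.hyps by simp
  qed
  also have "\<dots> = ennreal (1 - p) * (\<integral>\<^sup>+ xs. \<psi> (c + (\<Sum>i\<in>I. g (xs i))) \<partial>PiM I (\<lambda>_. M))
     + ennreal p * (\<integral>\<^sup>+ xs. \<psi> ((c + 1) + (\<Sum>i\<in>I. g (xs i))) \<partial>PiM I (\<lambda>_. M))"
    using p \<psi>_nonneg
    by (simp add: ennreal_mult' ennreal_plus nn_integral_add nn_integral_cmult add_ac)
  also have "\<dots> \<le> ennreal (1 - p) * (\<Sum>k\<le>card I. real (card I choose k) * p ^ k * (1 - p) ^ (card I - k) * \<psi> (c + real k))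
     + ennreal p * (\<Sum>k\<le>card I. real (card I choose k) * p ^ k * (1 - p) ^ (card I - k) * \<psi> ((c + 1) + real k))"
    using insert.prems insert.hyps by (intro add_mono mult_left_mono insert.IH) auto
  also have "\<dots> = ennreal (\<Sum>k\<le>Suc (card I). real (Suc (card I) choose k) * p ^ k * (1 - p) ^ (Suc (card I) - k) * \<psi> (c + real k))"
    unfolding binomial_average_Suc using p \<psi>_nonneg
    by (simp add: ennreal_mult' ennreal_plus sum_nonneg)
  finally show ?case using insert.hyps by simp
qed

section \<open>Exponential moments of empirical means\<close>

lemma (in prob_space) nn_integral_exp_kl_le:
  fixes g :: "'a \<Rightarrow> real"
  assumes g [measurable]: "g \<in> borel_measurable M"
    and g_range: "\<And>x. x \<in> space M \<Longrightarrow> 0 \<le> g x \<and> g x \<le> 1"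
    and n: "n \<ge> 3"
  shows "(\<integral>\<^sup>+ xs. eexp (ereal (real n) * kl ((\<Sum>i<n. g (xs i)) / real n) (expectation g)) \<partial>sample_space M n)
    \<le> ennreal (2 * sqrt (real n))"
proof -
  define p where "p = expectation g"
  interpret P: prob_space "sample_space M n" by (intro prob_space_PiM prob_space_axioms)
  have int_g: "integrable M g"
    using g_range by (intro integrable_const_bound[where B = 1]) auto
  have p: "0 \<le> p" "p \<le> 1"
    using g_range int_g by (auto simp: p_def intro!: integral_nonneg_AE integral_le_const)
  \<comment> \<open>For p = 0 or p = 1 \<open>kl\<close> can be infinite. But g then equals p almost
    everywhere, so the empirical mean is almost surely p and the divergence is 0.\<close>
  have degenerate: ?thesis if e: "e = 0 \<or> e = 1" and p_eq: "p = e" and ae: "AE x in M. g x = e" for e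
  proof -
    have "AE xs in sample_space M n. g (xs i) = e" if "i < n" for i
      using that ae prob_space_axioms by (intro AE_PiM_component) auto
    then have "AE xs in sample_space M n. \<forall>i\<in>{..<n}. g (xs i) = e"
      by (intro AE_finite_allI) auto
    then have "(\<integral>\<^sup>+ xs. eexp (ereal (real n) * kl ((\<Sum>i<n. g (xs i)) / real n) p) \<partial>sample_space M n)
      = (\<integral>\<^sup>+ xs. 1 \<partial>sample_space M n)"
    proof (intro nn_integral_cong_AE, eventually_elim)
      case (elim xs)
      then have "(\<Sum>i<n. g (xs i)) / real n = e" using n by simp
      then show ?case using e p_eq by (auto simp: kl_def eexp_def zero_ereal_def [symmetric])
    qed
    also have "\<dots> = 1" by (simp add: P.emeasure_space_1)
    also have "1 \<le> ennreal (2 * sqrt (real n))"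
    proof -
      have "1 \<le> sqrt (real n)" using n by simp
      then have "1 \<le> 2 * sqrt (real n)" by linarith
      then show ?thesis by (metis ennreal_1 ennreal_leI)
    qed
    finally show ?thesis by (simp add: p_def)
  qed
  consider "p = 0" | "p = 1" | "0 < p" "p < 1" using p by fastforce
  then show ?thesis
  proof cases
    case 1
    then have "AE x in M. g x = 0"
      using integral_nonneg_eq_0_iff_AE[OF int_g] g_range by (auto simp: p_def)
    with 1 degenerate[of 0] show ?thesis by simp
  next
    case 2
    then have "(\<integral>x. 1 - g x \<partial>M) = 0" using int_g by (simp add: p_def prob_space)
    then have "AE x in M. 1 - g x = 0"
      using integral_nonneg_eq_0_iff_AE[of M "\<lambda>x. 1 - g x"] int_g g_range by auto
    then have "AE x in M. g x = 1" by eventually_elim simp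
    with 2 degenerate[of 1] show ?thesis by simp
  next
    case 3
    define \<psi> where "\<psi> = (\<lambda>c. exp (real n * bernoulli_divergence (c / real n) p))"
    have [measurable]: "\<psi> \<in> borel_measurable borel"
      unfolding \<psi>_def bernoulli_divergence_def by measurable
    have "(\<integral>\<^sup>+ xs. eexp (ereal (real n) * kl ((\<Sum>i<n. g (xs i)) / real n) p) \<partial>sample_space M n)
      = (\<integral>\<^sup>+ xs. \<psi> (0 + (\<Sum>i<n. g (xs i))) \<partial>sample_space M n)"
      using 3 by (simp add: kl_eq_bernoulli_divergence eexp_def \<psi>_def)
    also have "\<dots> \<le> (\<Sum>k\<le>card {..<n}. real (card {..<n} choose k) * p ^ k * (1 - p) ^ (card {..<n} - k) * \<psi> (0 + real k))"
      unfolding p_def using n 3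
      by (intro nn_integral_convex_sum_le_binomial[where N = "real n"] g g_range)
         (auto simp flip: p_def, auto simp: \<psi>_def intro!: convex_on_exp_bernoulli_divergence)
    also have "(\<Sum>k\<le>card {..<n}. real (card {..<n} choose k) * p ^ k * (1 - p) ^ (card {..<n} - k) * \<psi> (0 + real k))
      = (\<Sum>k\<le>n. real (n choose k) * (real k / real n) ^ k * (1 - real k / real n) ^ (n - k))"
      unfolding card_lessThan
    proof (intro sum.cong refl)
      fix k assume k: "k \<in> {..n}"
      \<comment> \<open>The exponential at k is (s/p)^k ((1-s)/(1-p))^(n-k), so it cancels the
        powers of p and 1 - p in the binomial weight. For k = 0 and k = n the logarithm of 0 has
        coefficient 0, matching a power with exponent 0.\<close>
      define s where "s = real k / real n"
      have "real n * bernoulli_divergence s p = real k * ln (s / p) + real (n - k) * ln ((1 - s) / (1 - p))"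
        using n k by (simp add: bernoulli_divergence_def s_def of_nat_diff field_simps)
      moreover have "exp (real k * ln (s / p)) = (s / p) ^ k"
        using 3 n by (cases "k = 0") (auto simp: exp_of_nat_mult s_def)
      moreover have "exp (real (n - k) * ln ((1 - s) / (1 - p))) = ((1 - s) / (1 - p)) ^ (n - k)"
        unfolding exp_of_nat_mult using 3 n k by (cases "k = n") (auto simp: s_def)
      ultimately have "\<psi> (real k) = (s / p) ^ k * ((1 - s) / (1 - p)) ^ (n - k)"
        by (simp add: \<psi>_def s_def [symmetric] exp_add)
      then show "real (n choose k) * p ^ k * (1 - p) ^ (n - k) * \<psi> (0 + real k)
        = real (n choose k) * (real k / real n) ^ k * (1 - real k / real n) ^ (n - k)"
        using 3 by (simp add: power_divide s_def [symmetric])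
    qed
    also have "ennreal (\<Sum>k\<le>n. real (n choose k) * (real k / real n) ^ k * (1 - real k / real n) ^ (n - k))
      \<le> ennreal (2 * sqrt (real n))"
      using n by (intro ennreal_leI binomial_entropy_sum_le)
    finally show ?thesis by (simp add: p_def)
  qed
qed

text \<open>Since (k + 2)! >= 2 * 3^k, the exponential series from its quadratic term on is
  dominated by a geometric series with ratio t/3.\<close>

lemma exp_le_quadratic:
  fixes y t :: real
  assumes y: "\<bar>y\<bar> \<le> t" and t: "t < 3"
  shows "exp y \<le> 1 + y + y\<^sup>2 / (2 * (1 - t / 3))"
proof -
  have fact_ge: "2 * 3 ^ k \<le> (fact (k + 2) :: real)" for k
  proof (induction k)
    case (Suc k)
    have "2 * 3 ^ Suc k = 3 * (2 * 3 ^ k :: real)" by simp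
    also have "\<dots> \<le> (real k + 3) * fact (k + 2)" using Suc by (intro mult_mono) auto
    also have "\<dots> = fact (Suc k + 2)" by (simp add: algebra_simps)
    finally show ?case .
  qed (simp add: fact_numeral)
  have t0: "0 \<le> t" using y by linarith
  have "(\<lambda>k. y ^ k / fact k) sums exp y"
    using exp_converges[of y] by (simp add: divide_inverse mult_ac scaleR_conv_of_real)
  then have "(\<lambda>k. y ^ (k + 2) / fact (k + 2)) sums (exp y - (\<Sum>k<2. y ^ k / fact k))"
    by (rule sums_split_initial_segment)
  then have 1: "(\<lambda>k. y ^ (k + 2) / fact (k + 2)) sums (exp y - (1 + y))"
    by (simp add: numeral_2_eq_2)
  have 2: "(\<lambda>k. y\<^sup>2 / 2 * (t / 3) ^ k) sums (y\<^sup>2 / 2 * (1 / (1 - t / 3)))"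
    using t t0 by (intro sums_mult geometric_sums) auto
  have "exp y - (1 + y) \<le> y\<^sup>2 / 2 * (1 / (1 - t / 3))"
  proof (rule sums_le[OF _ 1 2])
    fix k
    have "y ^ (k + 2) / fact (k + 2) \<le> \<bar>y\<bar> ^ (k + 2) / fact (k + 2)"
      by (intro divide_right_mono) (auto intro: order.trans[OF abs_ge_self] simp del: power_Suc simp flip: power_abs)
    also have "\<dots> \<le> \<bar>y\<bar> ^ (k + 2) / (2 * 3 ^ k)"
      using fact_ge[of k] by (intro divide_left_mono) auto
    also have "\<dots> = y\<^sup>2 / 2 * (\<bar>y\<bar> / 3) ^ k"
      by (simp add: power_add power_divide power2_eq_square)
    also have "\<dots> \<le> y\<^sup>2 / 2 * (t / 3) ^ k"
      using y by (intro mult_left_mono power_mono) auto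
    finally show "y ^ (k + 2) / fact (k + 2) \<le> y\<^sup>2 / 2 * (t / 3) ^ k" .
  qed
  then show ?thesis by simp
qed

text \<open>In the quadratic bound for exp the linear term has mean 0 and the quadratic one gives
  the variance; 1 + u <= exp u finishes.\<close>

lemma (in prob_space) nn_integral_exp_bernstein_le:
  fixes g :: "'a \<Rightarrow> real"
  assumes g [measurable]: "g \<in> borel_measurable M"
    and g_range: "\<And>x. x \<in> space M \<Longrightarrow> 0 \<le> g x \<and> g x \<le> 1"
    and t: "0 \<le> t" "t < 3"
  shows "(\<integral>\<^sup>+ x. exp (t * (expectation g - g x)) \<partial>M)
    \<le> exp (t\<^sup>2 / (2 * (1 - t / 3)) * (\<integral>x. (g x - expectation g)\<^sup>2 \<partial>M))"
proof -
  define p where "p = expectation g"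
  define K where "K = t\<^sup>2 / (2 * (1 - t / 3))"
  have int_g: "integrable M g"
    using g_range by (intro integrable_const_bound[where B = 1]) auto
  have p: "0 \<le> p" "p \<le> 1"
    using g_range int_g by (auto simp: p_def intro!: integral_nonneg_AE integral_le_const)
  have abs_le: "\<bar>p - g x\<bar> \<le> 1" if "x \<in> space M" for x
    using g_range[OF that] p by (auto simp: abs_le_iff)
  have int_sq: "integrable M (\<lambda>x. (g x - p)\<^sup>2)"
    using abs_le by (intro integrable_const_bound[where B = 1] AE_I2)
      (auto simp: abs_square_le_1 abs_minus_commute)
  have quad: "exp (t * (p - g x)) \<le> 1 + t * (p - g x) + K * (g x - p)\<^sup>2" if "x \<in> space M" for x
  proof -
    have "\<bar>t * (p - g x)\<bar> \<le> t"
      using abs_le[OF that] t by (simp add: abs_mult mult_left_le)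
    from exp_le_quadratic[OF this t(2)] show ?thesis
      by (simp add: K_def power_mult_distrib power2_commute)
  qed
  have "(\<integral>\<^sup>+ x. exp (t * (p - g x)) \<partial>M) \<le> (\<integral>\<^sup>+ x. ennreal (1 + t * (p - g x) + K * (g x - p)\<^sup>2) \<partial>M)"
    using quad by (intro nn_integral_mono ennreal_leI)
  also have "\<dots> = ennreal (\<integral>x. 1 + t * (p - g x) + K * (g x - p)\<^sup>2 \<partial>M)"
    using int_g int_sq order.trans[OF exp_ge_zero quad]
    by (intro nn_integral_eq_integral) auto
  also have "(\<integral>x. 1 + t * (p - g x) + K * (g x - p)\<^sup>2 \<partial>M) = 1 + K * (\<integral>x. (g x - p)\<^sup>2 \<partial>M)"
    using int_g int_sq by (simp add: prob_space) (simp add: p_def)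
  also have "ennreal \<dots> \<le> exp (K * (\<integral>x. (g x - p)\<^sup>2 \<partial>M))"
    by (intro ennreal_leI exp_ge_add_one_self)
  finally show ?thesis by (simp add: p_def K_def)
qed

lemma (in prob_space) nn_integral_exp_hoeffding_le:
  fixes g :: "'a \<Rightarrow> real"
  assumes g [measurable]: "g \<in> borel_measurable M"
    and g_range: "\<And>x. x \<in> space M \<Longrightarrow> 0 \<le> g x \<and> g x \<le> 1"
    and t: "0 < t"
  shows "(\<integral>\<^sup>+ x. exp (t * (expectation g - g x)) \<partial>M) \<le> exp (t\<^sup>2 / 8)"
proof -
  \<comment> \<open>Hoeffding's lemma is applied to -g, since the gap is the mean minus the observed
    value.\<close>
  interpret interval_bounded_random_variable M "\<lambda>x. - g x" "-1" 0
    using g_range by unfold_locales auto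
  show ?thesis
    using Hoeffdings_lemma_nn_integral[OF t] by simp
qed

lemma (in prob_space) nn_integral_exp_gap_le:
  fixes g :: "'a \<Rightarrow> real"
  assumes g [measurable]: "g \<in> borel_measurable M"
    and "n > 0"
    and le: "(\<integral>\<^sup>+ x. exp (l / real n * (expectation g - g x)) \<partial>M) \<le> ennreal (exp b)"
  shows "(\<integral>\<^sup>+ xs. exp (l * (expectation g - (\<Sum>i<n. g (xs i)) / real n)) \<partial>sample_space M n) \<le> exp (real n * b)"
proof -
  interpret product_sigma_finite "\<lambda>_. M" by (intro product_sigma_finite.intro sigma_finite_measure_axioms)
  have "l * (expectation g - (\<Sum>i<n. g (xs i)) / real n) = (\<Sum>i<n. l / real n * (expectation g - g (xs i)))" for xs
    using \<open>n > 0\<close> by (simp add: sum_subtractf right_diff_distrib sum_divide_distrib sum_distrib_left)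
  then have "(\<integral>\<^sup>+ xs. exp (l * (expectation g - (\<Sum>i<n. g (xs i)) / real n)) \<partial>sample_space M n)
    = (\<integral>\<^sup>+ xs. (\<Prod>i<n. ennreal (exp (l / real n * (expectation g - g (xs i))))) \<partial>sample_space M n)"
    by (simp add: exp_sum prod_ennreal)
  also have "\<dots> = (\<integral>\<^sup>+ x. exp (l / real n * (expectation g - g x)) \<partial>M) ^ n"
    by (subst product_nn_integral_prod) auto
  also have "\<dots> \<le> ennreal (exp b) ^ n" by (intro power_mono le) simp
  also have "\<dots> = exp (real n * b)" by (simp add: ennreal_power exp_of_nat_mult)
  finally show ?thesis .
qed

section \<open>Functions with bounded differences\<close>

text \<open>The square is expanded around m^2, with m the mean of g. As g^2 - m^2 = (g - m)(g + m)
  is at most 2 c B in size, the condition on \<beta> keeps the exponent in [-1, 1], where the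
  quadratic coefficient is 3/4. With s the second moment of g, the first-order term gives \<beta> (s
  - m^2), which with the factor exp (\<beta> m^2) restores \<beta> s; the second-order term is at
  most 4 \<beta>^2 c^2 s because m^2 <= s.\<close>

lemma (in prob_space) nn_integral_exp_square_le:
  fixes g :: "'a \<Rightarrow> real"
  assumes g [measurable]: "g \<in> borel_measurable M"
    and g_range: "\<And>x. x \<in> space M \<Longrightarrow> 0 \<le> g x \<and> g x \<le> B"
    and g_diff: "\<And>x y. x \<in> space M \<Longrightarrow> y \<in> space M \<Longrightarrow> \<bar>g x - g y\<bar> \<le> c"
    and \<beta>: "0 \<le> \<beta>" "2 * \<beta> * c * B \<le> 1"
  shows "(\<integral>\<^sup>+ x. exp (\<beta> * (g x)\<^sup>2) \<partial>M) \<le> exp (\<beta> * (1 + 4 * \<beta> * c\<^sup>2) * (\<integral>x. (g x)\<^sup>2 \<partial>M))"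
proof -
  define m where "m = expectation g"
  define s where "s = (\<integral>x. (g x)\<^sup>2 \<partial>M)"
  obtain x0 where x0: "x0 \<in> space M" using not_empty by auto
  have c0: "0 \<le> c" using g_diff[OF x0 x0] by simp
  have B0: "0 \<le> B" using g_range[OF x0] by simp
  have int_g: "integrable M g"
    using g_range by (intro integrable_const_bound[where B = B]) auto
  have int_g2: "integrable M (\<lambda>x. (g x)\<^sup>2)"
    using g_range by (intro integrable_const_bound[where B = "B\<^sup>2"]) (auto intro!: power_mono)
  have m: "0 \<le> m" "m \<le> B"
    using g_range int_g by (auto simp: m_def intro!: integral_nonneg_AE integral_le_const)
  have m_diff: "\<bar>g x - m\<bar> \<le> c" if x: "x \<in> space M" for x
  proof -
    have "g y \<le> g x + c" "g x - c \<le> g y" if "y \<in> space M" for y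
      using g_diff[OF that x] by linarith+
    then have "m \<le> g x + c" "g x - c \<le> m"
      unfolding m_def using int_g by (auto intro!: integral_le_const integral_ge_const)
    then show ?thesis by linarith
  qed
  have "variance g = s - m\<^sup>2"
    unfolding s_def m_def by (intro variance_eq int_g int_g2)
  then have m2: "m\<^sup>2 \<le> s" using variance_positive[of g] by linarith
  define Q where "Q = (\<lambda>x. 1 + \<beta> * ((g x)\<^sup>2 - m\<^sup>2) + \<beta>\<^sup>2 * (2 * c\<^sup>2 * (g x)\<^sup>2 + 2 * c\<^sup>2 * m\<^sup>2))"
  have pointwise: "exp (\<beta> * ((g x)\<^sup>2 - m\<^sup>2)) \<le> Q x" if x: "x \<in> space M" for x
  proof -
    have eq: "\<beta> * ((g x)\<^sup>2 - m\<^sup>2) = \<beta> * ((g x - m) * (g x + m))"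
      by (simp add: power2_eq_square algebra_simps)
    have "\<bar>\<beta> * ((g x)\<^sup>2 - m\<^sup>2)\<bar> = \<beta> * (\<bar>g x - m\<bar> * (g x + m))"
      unfolding eq using \<beta> m g_range[OF x] by (simp add: abs_mult)
    also have "\<dots> \<le> \<beta> * (c * (B + B))"
      using \<beta> m g_range[OF x] m_diff[OF x] c0 by (intro mult_left_mono mult_mono) auto
    also have "\<dots> \<le> 1" using \<beta> by (simp add: algebra_simps)
    finally have "exp (\<beta> * ((g x)\<^sup>2 - m\<^sup>2)) \<le> 1 + \<beta> * ((g x)\<^sup>2 - m\<^sup>2) + (\<beta> * ((g x)\<^sup>2 - m\<^sup>2))\<^sup>2 / (2 * (1 - 1 / 3))"
      by (rule exp_le_quadratic) simp
    also have "(\<beta> * ((g x)\<^sup>2 - m\<^sup>2))\<^sup>2 / (2 * (1 - 1 / 3)) \<le> (\<beta> * ((g x)\<^sup>2 - m\<^sup>2))\<^sup>2"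
      by simp
    also have "(\<beta> * ((g x)\<^sup>2 - m\<^sup>2))\<^sup>2 = \<beta>\<^sup>2 * (\<bar>g x - m\<bar>\<^sup>2 * (g x + m)\<^sup>2)"
      unfolding eq by (simp add: power_mult_distrib)
    also have "\<dots> \<le> \<beta>\<^sup>2 * (c\<^sup>2 * (2 * (g x)\<^sup>2 + 2 * m\<^sup>2))"
      using m_diff[OF x] sum_squares_bound[of "g x" m] zero_le_power2[of "g x + m"]
      by (intro mult_left_mono mult_mono power_mono) (auto simp: power2_sum)
    finally show ?thesis by (simp add: Q_def algebra_simps)
  qed
  have int_Q: "integrable M Q" unfolding Q_def using int_g2 by auto
  have "(\<integral>x. Q x \<partial>M) = 1 + \<beta> * (s - m\<^sup>2) + \<beta>\<^sup>2 * (2 * c\<^sup>2 * s + 2 * c\<^sup>2 * m\<^sup>2)"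
    unfolding Q_def using int_g2 by (simp add: s_def prob_space)
  also have "\<dots> \<le> 1 + (\<beta> * (s - m\<^sup>2) + \<beta>\<^sup>2 * (2 * c\<^sup>2 * s + 2 * c\<^sup>2 * s))"
    unfolding add.assoc using m2 by (intro add_left_mono mult_left_mono) auto
  also have "\<dots> \<le> exp (\<beta> * (s - m\<^sup>2) + \<beta>\<^sup>2 * (2 * c\<^sup>2 * s + 2 * c\<^sup>2 * s))"
    by (rule exp_ge_add_one_self)
  finally have EQ: "(\<integral>x. Q x \<partial>M) \<le> exp (\<beta> * (s - m\<^sup>2) + \<beta>\<^sup>2 * (2 * c\<^sup>2 * s + 2 * c\<^sup>2 * s))" .
  have "(\<integral>\<^sup>+ x. exp (\<beta> * (g x)\<^sup>2) \<partial>M) = (\<integral>\<^sup>+ x. ennreal (exp (\<beta> * m\<^sup>2)) * exp (\<beta> * ((g x)\<^sup>2 - m\<^sup>2)) \<partial>M)"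
    by (intro nn_integral_cong) (simp add: ennreal_mult' [symmetric] exp_add [symmetric] algebra_simps)
  also have "\<dots> = exp (\<beta> * m\<^sup>2) * (\<integral>\<^sup>+ x. exp (\<beta> * ((g x)\<^sup>2 - m\<^sup>2)) \<partial>M)"
    by (intro nn_integral_cmult) measurable
  also have "\<dots> \<le> exp (\<beta> * m\<^sup>2) * (\<integral>\<^sup>+ x. Q x \<partial>M)"
    using pointwise by (intro mult_left_mono nn_integral_mono ennreal_leI) auto
  also have "(\<integral>\<^sup>+ x. Q x \<partial>M) = ennreal (\<integral>x. Q x \<partial>M)"
    using int_Q order.trans[OF exp_ge_zero pointwise] by (intro nn_integral_eq_integral) auto
  also have "exp (\<beta> * m\<^sup>2) * \<dots> \<le> ennreal (exp (\<beta> * m\<^sup>2)) * exp (\<beta> * (s - m\<^sup>2) + \<beta>\<^sup>2 * (2 * c\<^sup>2 * s + 2 * c\<^sup>2 * s))"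
    by (intro mult_left_mono ennreal_leI EQ) simp
  also have "\<dots> = exp (\<beta> * (1 + 4 * \<beta> * c\<^sup>2) * s)"
    by (simp add: ennreal_mult' [symmetric] exp_add [symmetric]) (simp add: algebra_simps power2_eq_square)
  finally show ?thesis by (simp add: s_def)
qed

text \<open>Minkowski's inequality with a constant summand. The cross term 2 c E v is controlled by
  E v <= sqrt (E v^2), the nonnegativity of the variance.\<close>

lemma (in prob_space) sqrt_second_moment_diff_le:
  fixes u v :: "'a \<Rightarrow> real"
  assumes [measurable]: "u \<in> borel_measurable M" "v \<in> borel_measurable M"
    and u: "\<And>x. x \<in> space M \<Longrightarrow> 0 \<le> u x \<and> u x \<le> B"
    and v: "\<And>x. x \<in> space M \<Longrightarrow> 0 \<le> v x \<and> v x \<le> B"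
    and le: "\<And>x. x \<in> space M \<Longrightarrow> u x \<le> v x + c"
    and c: "0 \<le> c"
  shows "sqrt (\<integral>x. (u x)\<^sup>2 \<partial>M) \<le> sqrt (\<integral>x. (v x)\<^sup>2 \<partial>M) + c"
proof (rule real_le_lsqrt)
  have int_v: "integrable M v"
    using v by (intro integrable_const_bound[where B = B]) auto
  have int_v2: "integrable M (\<lambda>x. (v x)\<^sup>2)"
    using v by (intro integrable_const_bound[where B = "B\<^sup>2"]) (auto intro!: power_mono)
  have int_u2: "integrable M (\<lambda>x. (u x)\<^sup>2)"
    using u by (intro integrable_const_bound[where B = "B\<^sup>2"]) (auto intro!: power_mono)
  have v2: "0 \<le> (\<integral>x. (v x)\<^sup>2 \<partial>M)" by simp
  have "expectation v \<le> sqrt (\<integral>x. (v x)\<^sup>2 \<partial>M)"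
    using variance_positive[of v] variance_eq[OF int_v int_v2] by (intro real_le_rsqrt) simp
  then have mean_le: "2 * c * expectation v \<le> 2 * c * sqrt (\<integral>x. (v x)\<^sup>2 \<partial>M)"
    using c by (intro mult_left_mono) auto
  have "(\<integral>x. (u x)\<^sup>2 \<partial>M) \<le> (\<integral>x. (v x)\<^sup>2 + 2 * c * v x + c\<^sup>2 \<partial>M)"
  proof (intro integral_mono)
    fix x assume "x \<in> space M"
    then have "(u x)\<^sup>2 \<le> (v x + c)\<^sup>2" using u le by (intro power_mono) auto
    then show "(u x)\<^sup>2 \<le> (v x)\<^sup>2 + 2 * c * v x + c\<^sup>2" by (simp add: power2_sum mult_ac)
  qed (use int_v int_v2 int_u2 in auto)
  also have "\<dots> = (\<integral>x. (v x)\<^sup>2 \<partial>M) + 2 * c * expectation v + c\<^sup>2"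
    using int_v int_v2 by (simp add: prob_space)
  also have "\<dots> \<le> (sqrt (\<integral>x. (v x)\<^sup>2 \<partial>M) + c)\<^sup>2"
    using mean_le v2 by (simp add: power2_sum mult_ac)
  finally show "(\<integral>x. (u x)\<^sup>2 \<partial>M) \<le> (sqrt (\<integral>x. (v x)\<^sup>2 \<partial>M) + c)\<^sup>2" .
qed (use c in auto)

text \<open>One coordinate is integrated out at a time. The root mean square of \<open>g\<close> over that coordinate
  again has bounded differences with the same constant (Minkowski), and each step inflates the
  exponent by at most the factor \<open>1 + \<theta>\<close>.\<close>

lemma (in prob_space) nn_integral_exp_square_bounded_differences_le:
  fixes g :: "('i \<Rightarrow> 'a) \<Rightarrow> real"
  assumes I: "finite I"
    and g: "g \<in> borel_measurable (PiM I (\<lambda>_. M))"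
    and g_range: "\<And>x. x \<in> space (PiM I (\<lambda>_. M)) \<Longrightarrow> 0 \<le> g x \<and> g x \<le> B"
    and g_diff: "\<And>x k y y'. x \<in> space (PiM I (\<lambda>_. M)) \<Longrightarrow> k \<in> I \<Longrightarrow> y \<in> space M \<Longrightarrow> y' \<in> space M
      \<Longrightarrow> \<bar>g (x(k := y)) - g (x(k := y'))\<bar> \<le> c"
    and c: "0 \<le> c" and B: "0 \<le> B" and \<theta>: "0 \<le> \<theta>"
    and \<beta>: "0 \<le> \<beta>" "\<beta> * (1 + \<theta>) ^ card I \<le> b"
    and b: "4 * b * c\<^sup>2 \<le> \<theta>" "2 * b * c * B \<le> 1"
  shows "(\<integral>\<^sup>+ x. exp (\<beta> * (g x)\<^sup>2) \<partial>PiM I (\<lambda>_. M))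
    \<le> exp (\<beta> * (1 + \<theta>) ^ card I * (\<integral>x. (g x)\<^sup>2 \<partial>PiM I (\<lambda>_. M)))"
  using I g g_range g_diff \<beta>
proof (induction I arbitrary: g \<beta> rule: finite_induct)
  case empty
  then show ?case
    by (simp add: PiM_empty nn_integral_count_space_finite lebesgue_integral_count_space_finite)
next
  case (insert j I)
  interpret product_sigma_finite "\<lambda>_. M" by (intro product_sigma_finite.intro sigma_finite_measure_axioms)
  interpret P: prob_space "PiM (insert j I) (\<lambda>_. M)" by (intro prob_space_PiM prob_space_axioms)
  note [measurable] = insert.prems(1)
  note range = insert.prems(2) and diff = insert.prems(3)
  \<comment> \<open>The bound b on the final exponent also bounds the current one, so the two
    smallness conditions on b are available at every level of the induction.\<close>
  have "\<beta> * 1 \<le> \<beta> * (1 + \<theta>) ^ card (insert j I)"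
    using insert.prems \<theta> by (intro mult_left_mono one_le_power) auto
  then have \<beta>_le: "\<beta> \<le> b" using insert.prems by simp
  have upd: "x(j := y) \<in> space (PiM (insert j I) (\<lambda>_. M))"
    if "x \<in> space (PiM I (\<lambda>_. M))" "y \<in> space M" for x y
    using that by (auto simp: space_PiM PiE_iff extensional_def)
  have upd_meas [measurable]: "(\<lambda>y. x(j := y)) \<in> M \<rightarrow>\<^sub>M PiM (insert j I) (\<lambda>_. M)"
    if "x \<in> space (PiM I (\<lambda>_. M))" for x
    using that by measurable
  define G where "G = (\<lambda>x. sqrt (\<integral>y. (g (x(j := y)))\<^sup>2 \<partial>M))"
  have G_meas [measurable]: "G \<in> borel_measurable (PiM I (\<lambda>_. M))"
    unfolding G_def by measurable
  have int_g2: "integrable (PiM (insert j I) (\<lambda>_. M)) (\<lambda>x. (g x)\<^sup>2)"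
    using range by (intro P.integrable_const_bound[where B = "B\<^sup>2"]) (auto intro!: power_mono)
  have inner: "(\<integral>\<^sup>+ y. exp (\<beta> * (g (x(j := y)))\<^sup>2) \<partial>M) \<le> exp (\<beta> * (1 + \<theta>) * (G x)\<^sup>2)"
    if x: "x \<in> space (PiM I (\<lambda>_. M))" for x
  proof -
    have gx [measurable]: "(\<lambda>y. g (x(j := y))) \<in> borel_measurable M"
      using measurable_compose[OF upd_meas[OF x] insert.prems(1)] .
    obtain y0 where y0: "y0 \<in> space M" using not_empty by auto
    have "(\<integral>\<^sup>+ y. exp (\<beta> * (g (x(j := y)))\<^sup>2) \<partial>M) \<le> exp (\<beta> * (1 + 4 * \<beta> * c\<^sup>2) * (\<integral>y. (g (x(j := y)))\<^sup>2 \<partial>M))"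
    proof (rule nn_integral_exp_square_le[OF gx])
      show "0 \<le> g (x(j := y)) \<and> g (x(j := y)) \<le> B" if "y \<in> space M" for y
        using range upd[OF x that] by auto
      show "\<bar>g (x(j := y)) - g (x(j := y'))\<bar> \<le> c" if "y \<in> space M" "y' \<in> space M" for y y'
        using diff[OF upd[OF x y0], of j y y'] that unfolding fun_upd_upd by blast
      have "2 * \<beta> * c * B \<le> 2 * b * c * B"
        using \<beta>_le c B by (intro mult_right_mono mult_left_mono) auto
      then show "2 * \<beta> * c * B \<le> 1" using b by simp
    qed (use insert.prems in auto)
    also have "\<dots> \<le> exp (\<beta> * (1 + \<theta>) * (\<integral>y. (g (x(j := y)))\<^sup>2 \<partial>M))"
    proof -
      have "4 * \<beta> * c\<^sup>2 \<le> 4 * b * c\<^sup>2" using \<beta>_le by (intro mult_right_mono) auto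
      then show ?thesis
        using insert.prems b by (intro ennreal_leI) (auto intro!: mult_right_mono mult_left_mono)
    qed
    also have "(\<integral>y. (g (x(j := y)))\<^sup>2 \<partial>M) = (G x)\<^sup>2" by (simp add: G_def)
    finally show ?thesis .
  qed
  have "(\<integral>\<^sup>+ x. exp (\<beta> * (g x)\<^sup>2) \<partial>PiM (insert j I) (\<lambda>_. M))
      = (\<integral>\<^sup>+ x. (\<integral>\<^sup>+ y. exp (\<beta> * (g (x(j := y)))\<^sup>2) \<partial>M) \<partial>PiM I (\<lambda>_. M))"
    using insert.hyps by (intro product_nn_integral_insert) auto
  also have "\<dots> \<le> (\<integral>\<^sup>+ x. exp (\<beta> * (1 + \<theta>) * (G x)\<^sup>2) \<partial>PiM I (\<lambda>_. M))"
    by (intro nn_integral_mono inner)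
  also have "\<dots> \<le> exp (\<beta> * (1 + \<theta>) * (1 + \<theta>) ^ card I * (\<integral>x. (G x)\<^sup>2 \<partial>PiM I (\<lambda>_. M)))"
  proof (rule insert.IH[OF G_meas])
    fix x assume x: "x \<in> space (PiM I (\<lambda>_. M))"
    have gx [measurable]: "(\<lambda>y. g (x(j := y))) \<in> borel_measurable M" if "x \<in> space (PiM I (\<lambda>_. M))" for x
      using measurable_compose[OF upd_meas[OF that] insert.prems(1)] .
    have "(\<integral>y. (g (x(j := y)))\<^sup>2 \<partial>M) \<le> B\<^sup>2"
    proof (rule integral_le_const)
      have "integrable M (\<lambda>y. (g (x(j := y)))\<^sup>2)"
        using range upd[OF x] gx[OF x] by (intro integrable_const_bound[where B = "B\<^sup>2"]) (auto intro!: power_mono AE_I2)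
      then show "integrable M (\<lambda>y. (g (x(j := y)))\<^sup>2)" .
    qed (use range upd[OF x] in \<open>auto intro!: power_mono AE_I2\<close>)
    then show "0 \<le> G x \<and> G x \<le> B"
      using B by (auto simp: G_def intro: real_le_lsqrt)
    fix k y y' assume k: "k \<in> I" and y: "y \<in> space M" "y' \<in> space M"
    have upd_k: "x(k := y) \<in> space (PiM I (\<lambda>_. M))" if "y \<in> space M" for y
      using x k that by (auto simp: space_PiM PiE_iff extensional_def)
    have "G (x(k := y)) \<le> G (x(k := y')) + c" if y: "y \<in> space M" "y' \<in> space M" for y y'
      unfolding G_def
    proof (rule sqrt_second_moment_diff_le[OF gx[OF upd_k] gx[OF upd_k]])
      fix z assume z: "z \<in> space M"
      have "k \<noteq> j" using k insert.hyps by auto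
      then have twist: "x(k := y, j := z) = (x(j := z))(k := y)" for y by (rule fun_upd_twist)
      have "\<bar>g ((x(j := z))(k := y)) - g ((x(j := z))(k := y'))\<bar> \<le> c"
        using diff[OF upd[OF x z], of k y y'] k y by blast
      then show "g (x(k := y, j := z)) \<le> g (x(k := y', j := z)) + c"
        unfolding twist by linarith
    qed (use range upd[OF upd_k] y c in auto)
    from this[OF y] this[OF y(2,1)] show "\<bar>G (x(k := y)) - G (x(k := y'))\<bar> \<le> c" by linarith
  qed (use insert.prems insert.hyps \<theta> in \<open>auto simp: mult_ac\<close>)
  also have "(\<integral>x. (G x)\<^sup>2 \<partial>PiM I (\<lambda>_. M)) = (\<integral>x. (g x)\<^sup>2 \<partial>PiM (insert j I) (\<lambda>_. M))"
    using insert.hyps int_g2 by (subst product_integral_insert) (auto simp: G_def)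
  finally show ?case using insert.hyps by (simp add: mult_ac)
qed

section \<open>Gaussian densities\<close>

text \<open>The normalising constant, (2 pi \<sigma>^2)^(d/2) for \<sigma> > 0, kept as an integral:
  the argument rests on its being finite, positive and the same for every centre. The
  \<open>itself\<close> argument fixes the space.\<close>

definition gauss_mass :: "'h::euclidean_space itself \<Rightarrow> real \<Rightarrow> real" where
  "gauss_mass _ \<sigma> = (\<integral>h. exp (- (norm (h :: 'h))\<^sup>2 / (2 * \<sigma>\<^sup>2)) \<partial>lborel)"

lemma nn_integral_gauss_finite:
  fixes \<sigma> :: real
  assumes "\<sigma> > 0"
  shows "(\<integral>\<^sup>+h. exp (- (norm (h :: 'h::euclidean_space))\<^sup>2 / (2 * \<sigma>\<^sup>2)) \<partial>lborel) < \<infinity>"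
proof -
  have "(norm h)\<^sup>2 = (\<Sum>b\<in>Basis. (h \<bullet> b)\<^sup>2)" for h :: 'h
    unfolding power2_norm_eq_inner by (subst euclidean_inner) (simp add: power2_eq_square)
  then have "exp (- (norm h)\<^sup>2 / (2 * \<sigma>\<^sup>2)) = (\<Prod>b\<in>Basis. exp (- (h \<bullet> b)\<^sup>2 / (2 * \<sigma>\<^sup>2)))" for h :: 'h
    by (simp add: sum_negf sum_divide_distrib flip: exp_sum)
  then have "(\<integral>\<^sup>+h. exp (- (norm (h :: 'h))\<^sup>2 / (2 * \<sigma>\<^sup>2)) \<partial>lborel)
    = (\<integral>\<^sup>+h. (\<Prod>b\<in>Basis. ennreal (exp (- (h \<bullet> b)\<^sup>2 / (2 * \<sigma>\<^sup>2)))) \<partial>(lborel :: 'h measure))"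
    by (simp add: prod_ennreal)
  also have "\<dots> = (\<Prod>b\<in>(Basis :: 'h set). (\<integral>\<^sup>+x. ennreal (exp (- x\<^sup>2 / (2 * \<sigma>\<^sup>2))) \<partial>lborel))"
    by (intro nn_integral_lborel_prod) auto
  also have "(\<integral>\<^sup>+x. ennreal (exp (- x\<^sup>2 / (2 * \<sigma>\<^sup>2))) \<partial>lborel) < \<infinity>"
  proof -
    have "integrable lborel (\<lambda>x. sqrt (2 * pi * \<sigma>\<^sup>2) * normal_density 0 \<sigma> x)"
      using assms by (intro integrable_mult_right integrable_normal_density)
    moreover have "sqrt (2 * pi * \<sigma>\<^sup>2) * normal_density 0 \<sigma> x = exp (- x\<^sup>2 / (2 * \<sigma>\<^sup>2))" for x
      using assms by (simp add: normal_density_def)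
    ultimately have "integrable lborel (\<lambda>x. exp (- x\<^sup>2 / (2 * \<sigma>\<^sup>2)))" by simp
    then show ?thesis by (simp add: integrable_iff_bounded)
  qed
  then have "(\<Prod>b\<in>(Basis :: 'h set). (\<integral>\<^sup>+x. ennreal (exp (- x\<^sup>2 / (2 * \<sigma>\<^sup>2))) \<partial>lborel)) < \<infinity>"
    by (simp add: power_less_top_ennreal)
  finally show ?thesis .
qed

lemma nn_integral_gauss:
  fixes \<sigma> :: real and a :: "'h::euclidean_space"
  assumes "\<sigma> > 0"
  shows "(\<integral>\<^sup>+h. exp (- (norm (h - a))\<^sup>2 / (2 * \<sigma>\<^sup>2)) \<partial>lborel) = ennreal (gauss_mass TYPE('h) \<sigma>)"
proof -
  have "(\<integral>\<^sup>+h. exp (- (norm (h - a))\<^sup>2 / (2 * \<sigma>\<^sup>2)) \<partial>lborel)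
    = (\<integral>\<^sup>+h. exp (- (norm (h - a))\<^sup>2 / (2 * \<sigma>\<^sup>2)) \<partial>distr lborel borel ((+) a))"
    by (simp only: lborel_distr_plus)
  also have "\<dots> = (\<integral>\<^sup>+h. exp (- (norm (h :: 'h))\<^sup>2 / (2 * \<sigma>\<^sup>2)) \<partial>lborel)"
    by (subst nn_integral_distr) auto
  also have "\<dots> = ennreal (gauss_mass TYPE('h) \<sigma>)"
    unfolding gauss_mass_def using nn_integral_gauss_finite[OF assms, where 'h = 'h]
    by (intro nn_integral_eq_integral) (auto simp: integrable_iff_bounded)
  finally show ?thesis .
qed

lemma gauss_mass_pos:
  assumes "\<sigma> > 0"
  shows "gauss_mass TYPE('h::euclidean_space) \<sigma> > 0"
proof (rule ccontr)
  assume "\<not> ?thesis"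
  then have "(\<integral>\<^sup>+h. exp (- (norm (h - (0 :: 'h)))\<^sup>2 / (2 * \<sigma>\<^sup>2)) \<partial>lborel) = 0"
    unfolding nn_integral_gauss[OF assms] by (simp add: ennreal_eq_0_iff)
  then have "AE h in (lborel :: 'h measure). False"
    by (subst (asm) nn_integral_0_iff_AE) auto
  then show False by (simp add: eventually_False ae_filter_eq_bot_iff)
qed

lemma integral_gauss:
  fixes \<sigma> :: real and a :: "'h::euclidean_space"
  assumes "\<sigma> > 0"
  shows "(\<integral>h. exp (- (norm (h - a))\<^sup>2 / (2 * \<sigma>\<^sup>2)) \<partial>lborel) = gauss_mass TYPE('h) \<sigma>"
  using nn_integral_gauss[OF assms, of a] gauss_mass_pos[OF assms, where 'h = 'h]
  by (subst integral_eq_nn_integral) auto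

definition gauss_density :: "real \<Rightarrow> 'h::euclidean_space \<Rightarrow> 'h \<Rightarrow> real" where
  "gauss_density \<sigma> a h = exp (- (norm (h - a))\<^sup>2 / (2 * \<sigma>\<^sup>2)) / gauss_mass TYPE('h) \<sigma>"

lemma gauss_density_measurable [measurable]:
  "(\<lambda>x. gauss_density \<sigma> (a x) (h x)) \<in> borel_measurable N"
  if [measurable]: "a \<in> borel_measurable N" "h \<in> borel_measurable N"
  unfolding gauss_density_def by measurable

lemma gauss_density_pos: "\<sigma> > 0 \<Longrightarrow> gauss_density \<sigma> a h > 0"
  unfolding gauss_density_def by (intro divide_pos_pos gauss_mass_pos) auto

lemma nn_integral_gauss_density:
  fixes a :: "'h::euclidean_space"
  assumes "\<sigma> > 0"
  shows "(\<integral>\<^sup>+h. gauss_density \<sigma> a h \<partial>lborel) = 1"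
proof -
  have "(\<integral>\<^sup>+h. gauss_density \<sigma> a h \<partial>lborel)
    = (\<integral>\<^sup>+h. ennreal (exp (- (norm (h - a))\<^sup>2 / (2 * \<sigma>\<^sup>2))) / ennreal (gauss_mass TYPE('h) \<sigma>) \<partial>lborel)"
    unfolding gauss_density_def by (simp add: divide_ennreal gauss_mass_pos[OF assms])
  also have "\<dots> = (\<integral>\<^sup>+h. exp (- (norm (h - a))\<^sup>2 / (2 * \<sigma>\<^sup>2)) \<partial>lborel) / ennreal (gauss_mass TYPE('h) \<sigma>)"
    by (intro nn_integral_divide) measurable
  also have "\<dots> = 1"
    unfolding nn_integral_gauss[OF assms]
    using gauss_mass_pos[OF assms, where 'h = 'h] by (simp add: divide_ennreal)
  finally show ?thesis .
qed

lemma gibbs_eq_gauss: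
  fixes A :: "'z \<Rightarrow> 'h::euclidean_space"
  assumes "\<sigma> > 0"
  shows "gibbs (\<lambda>h xs. - (norm (h - A xs))\<^sup>2 / (2 * \<sigma>\<^sup>2)) xs = density lborel (\<lambda>h. ennreal (gauss_density \<sigma> (A xs) h))"
  unfolding gibbs_def gauss_density_def integral_gauss[OF assms] ..

text \<open>The quotient is again a Gaussian density, centred at the reflection 2 a - m of m through
  a, times a factor without h. Integrating over h therefore leaves only that factor, whatever the
  dimension.\<close>

lemma gauss_density_square_divide:
  fixes a m :: "'h::euclidean_space"
  assumes "\<sigma> > 0"
  shows "(gauss_density \<sigma> a h)\<^sup>2 / gauss_density \<sigma> m h
    = exp ((norm (a - m))\<^sup>2 / \<sigma>\<^sup>2) * gauss_density \<sigma> (2 *\<^sub>R a - m) h"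
proof -
  have "2 * (- (norm (h - a))\<^sup>2) + (norm (h - m))\<^sup>2 = 2 * (norm (a - m))\<^sup>2 - (norm (h - (2 *\<^sub>R a - m)))\<^sup>2"
    by (simp add: power2_norm_eq_inner algebra_simps inner_commute)
  then have "(2 * (- (norm (h - a))\<^sup>2) + (norm (h - m))\<^sup>2) / (2 * \<sigma>\<^sup>2)
    = (2 * (norm (a - m))\<^sup>2 - (norm (h - (2 *\<^sub>R a - m)))\<^sup>2) / (2 * \<sigma>\<^sup>2)" by simp
  then have "2 * (- (norm (h - a))\<^sup>2 / (2 * \<sigma>\<^sup>2)) - (- (norm (h - m))\<^sup>2 / (2 * \<sigma>\<^sup>2))
    = (norm (a - m))\<^sup>2 / \<sigma>\<^sup>2 + (- (norm (h - (2 *\<^sub>R a - m)))\<^sup>2 / (2 * \<sigma>\<^sup>2))"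
    using assms by (simp add: field_simps)
  then have "exp (- (norm (h - a))\<^sup>2 / (2 * \<sigma>\<^sup>2)) ^ 2 / exp (- (norm (h - m))\<^sup>2 / (2 * \<sigma>\<^sup>2))
    = exp ((norm (a - m))\<^sup>2 / \<sigma>\<^sup>2) * exp (- (norm (h - (2 *\<^sub>R a - m)))\<^sup>2 / (2 * \<sigma>\<^sup>2))"
    by (simp only: exp_double [symmetric] exp_diff [symmetric] exp_add [symmetric])
  then show ?thesis
    using gauss_mass_pos[OF assms, where 'h = 'h]
    by (simp add: gauss_density_def power_divide power2_eq_square field_simps)
qed

text \<open>Cauchy-Schwarz, after splitting the factor \<open>\<surd>(gauss_density \<sigma> m h)\<close> off the integrand.\<close>

lemma (in prob_space) gauss_change_of_measure:
  fixes A :: "'a \<Rightarrow> 'h::euclidean_space" and G :: "'h \<Rightarrow> 'a \<Rightarrow> ennreal"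
  assumes \<sigma>: "\<sigma> > 0"
    and A [measurable]: "A \<in> borel_measurable M"
    and G [measurable]: "(\<lambda>(h, x). G h x) \<in> borel_measurable (lborel \<Otimes>\<^sub>M M)"
    and G_le: "\<And>h. (\<integral>\<^sup>+ x. (G h x)\<^sup>2 \<partial>M) \<le> K"
  shows "(\<integral>\<^sup>+ x. (\<integral>\<^sup>+ h. G h x \<partial>density lborel (\<lambda>h. ennreal (gauss_density \<sigma> (A x) h))) \<partial>M)\<^sup>2
    \<le> K * (\<integral>\<^sup>+ x. exp ((norm (A x - m))\<^sup>2 / \<sigma>\<^sup>2) \<partial>M)"
proof -
  interpret L: pair_sigma_finite lborel M
    by (intro pair_sigma_finite.intro sigma_finite_lborel sigma_finite_measure_axioms)
  define u where "u = (\<lambda>(h, x). G h x * ennreal (sqrt (gauss_density \<sigma> m h)))"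
  define v where "v = (\<lambda>(h, x). ennreal (gauss_density \<sigma> (A x) h / sqrt (gauss_density \<sigma> m h)))"
  have [measurable]: "u \<in> borel_measurable (lborel \<Otimes>\<^sub>M M)" "v \<in> borel_measurable (lborel \<Otimes>\<^sub>M M)"
    unfolding u_def v_def by measurable
  have pos: "gauss_density \<sigma> a h > 0" for a h :: 'h by (rule gauss_density_pos[OF \<sigma>])
  have uv: "ennreal (gauss_density \<sigma> (A x) h) * G h x = u (h, x) * v (h, x)" for h x
    using pos[of m h] pos[of "A x" h]
    by (simp add: u_def v_def mult.assoc mult.commute ennreal_mult' [symmetric])
  have "(\<integral>\<^sup>+ x. (\<integral>\<^sup>+ h. G h x \<partial>density lborel (\<lambda>h. ennreal (gauss_density \<sigma> (A x) h))) \<partial>M)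
    = (\<integral>\<^sup>+ x. (\<integral>\<^sup>+ h. u (h, x) * v (h, x) \<partial>lborel) \<partial>M)"
    by (intro nn_integral_cong) (simp add: nn_integral_density uv)
  also have "\<dots> = (\<integral>\<^sup>+ z. u z * v z \<partial>(lborel \<Otimes>\<^sub>M M))"
    by (subst L.nn_integral_snd [symmetric]) auto
  finally have "(\<integral>\<^sup>+ x. (\<integral>\<^sup>+ h. G h x \<partial>density lborel (\<lambda>h. ennreal (gauss_density \<sigma> (A x) h))) \<partial>M)\<^sup>2
    \<le> (\<integral>\<^sup>+ z. (u z)\<^sup>2 \<partial>(lborel \<Otimes>\<^sub>M M)) * (\<integral>\<^sup>+ z. (v z)\<^sup>2 \<partial>(lborel \<Otimes>\<^sub>M M))"
    by (simp add: Cauchy_Schwarz_nn_integral)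
  also have "(\<integral>\<^sup>+ z. (u z)\<^sup>2 \<partial>(lborel \<Otimes>\<^sub>M M)) \<le> K"
  proof -
    have "(\<integral>\<^sup>+ z. (u z)\<^sup>2 \<partial>(lborel \<Otimes>\<^sub>M M)) = (\<integral>\<^sup>+ h. (\<integral>\<^sup>+ x. (u (h, x))\<^sup>2 \<partial>M) \<partial>lborel)"
      by (subst nn_integral_fst [symmetric]) auto
    also have "\<dots> = (\<integral>\<^sup>+ h. (\<integral>\<^sup>+ x. ennreal (gauss_density \<sigma> m h) * (G h x)\<^sup>2 \<partial>M) \<partial>lborel)"
      using pos[of m] by (intro nn_integral_cong)
        (simp add: u_def power_mult_distrib ennreal_power less_imp_le mult.commute)
    \<comment> \<open>The density centred at m does not involve x and leaves the inner integral;
      here the moment bound for fixed h enters.\<close>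
    also have "\<dots> = (\<integral>\<^sup>+ h. ennreal (gauss_density \<sigma> m h) * (\<integral>\<^sup>+ x. (G h x)\<^sup>2 \<partial>M) \<partial>lborel)"
      by (intro nn_integral_cong nn_integral_cmult) auto
    also have "\<dots> \<le> (\<integral>\<^sup>+ h. ennreal (gauss_density \<sigma> m h) * K \<partial>lborel)"
      by (intro nn_integral_mono mult_left_mono G_le) auto
    also have "\<dots> = K"
      by (simp add: nn_integral_multc nn_integral_gauss_density[OF \<sigma>])
    finally show ?thesis .
  qed
  also have "(\<integral>\<^sup>+ z. (v z)\<^sup>2 \<partial>(lborel \<Otimes>\<^sub>M M)) = (\<integral>\<^sup>+ x. exp ((norm (A x - m))\<^sup>2 / \<sigma>\<^sup>2) \<partial>M)"
  proof -
    have "(\<integral>\<^sup>+ z. (v z)\<^sup>2 \<partial>(lborel \<Otimes>\<^sub>M M)) = (\<integral>\<^sup>+ x. (\<integral>\<^sup>+ h. (v (h, x))\<^sup>2 \<partial>lborel) \<partial>M)"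
      by (subst L.nn_integral_snd [symmetric]) auto
    also have "\<dots> = (\<integral>\<^sup>+ x. (\<integral>\<^sup>+ h. ennreal (exp ((norm (A x - m))\<^sup>2 / \<sigma>\<^sup>2)) * ennreal (gauss_density \<sigma> (2 *\<^sub>R A x - m) h) \<partial>lborel) \<partial>M)"
    proof (intro nn_integral_cong)
      fix x h
      have "(v (h, x))\<^sup>2 = ennreal ((gauss_density \<sigma> (A x) h)\<^sup>2 / gauss_density \<sigma> m h)"
        using pos[of m h] pos[of "A x" h] by (simp add: v_def ennreal_power power_divide)
      then show "(v (h, x))\<^sup>2 = ennreal (exp ((norm (A x - m))\<^sup>2 / \<sigma>\<^sup>2)) * ennreal (gauss_density \<sigma> (2 *\<^sub>R A x - m) h)"
        by (simp add: gauss_density_square_divide[OF \<sigma>] ennreal_mult')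
    qed
    also have "\<dots> = (\<integral>\<^sup>+ x. exp ((norm (A x - m))\<^sup>2 / \<sigma>\<^sup>2) \<partial>M)"
      by (intro nn_integral_cong) (simp add: nn_integral_cmult nn_integral_gauss_density[OF \<sigma>])
    finally show ?thesis .
  qed
  finally show ?thesis by (simp add: mult_right_mono)
qed

section \<open>Gaussian randomization of a stable algorithm\<close>

text \<open>Probability bounds can thus be proved additively, without subtracting extended
  reals.\<close>

lemma ennreal_one_minus_le:
  assumes "1 \<le> J + ennreal \<delta>" "0 \<le> \<delta>"
  shows "ennreal (1 - \<delta>) \<le> J"
proof (cases J)
  case (real r)
  with assms have "ennreal 1 \<le> ennreal (r + \<delta>)" by (simp add: ennreal_plus)
  with assms real have "1 \<le> r + \<delta>" by (subst (asm) ennreal_le_iff) auto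
  with real show ?thesis by (auto intro!: ennreal_leI)
qed simp

lemma borel_measurable_kl [measurable]:
  assumes [measurable]: "s \<in> borel_measurable N" "t \<in> borel_measurable N"
  shows "(\<lambda>x. kl (s x) (t x)) \<in> borel_measurable N"
  unfolding kl_def by measurable

lemma borel_measurable_eexp [measurable]:
  assumes [measurable]: "z \<in> borel_measurable N"
  shows "(\<lambda>x. eexp (z x)) \<in> borel_measurable N"
  unfolding eexp_def by measurable

text \<open>Squaring under Cauchy-Schwarz turns the exponent (n/2) kl into n kl, infinite values
  included.\<close>

lemma eexp_square: "(eexp z)\<^sup>2 = eexp (2 * z)"
proof (cases z)
  case (real r)
  have "2 * ereal r = ereal (2 * r)" by simp
  with real show ?thesis by (simp add: eexp_def ennreal_power exp_double)
qed (auto simp: eexp_def)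

text \<open>An infinite sensitivity would make the left side of \<open>sens\<close> infinite, since
  n >= 1; taking y = y' in the supremum shows that it is nonnegative. Hence it is a real
  number.\<close>

lemma hyp_sens_bound:
  fixes A :: "(nat \<Rightarrow> 'x) \<Rightarrow> 'h::real_normed_vector"
  assumes "prob_space M" and n: "n \<ge> 1"
    and sens: "ereal (12 * real n) * (hyp_sens M n A)\<^sup>2 \<le> ereal (\<sigma>\<^sup>2)"
  obtains c where "0 \<le> c" "12 * real n * c\<^sup>2 \<le> \<sigma>\<^sup>2"
    and "\<And>x k y y'. x \<in> space (sample_space M n) \<Longrightarrow> k < n \<Longrightarrow> y \<in> space M \<Longrightarrow> y' \<in> space M
      \<Longrightarrow> norm (A (x(k := y)) - A (x(k := y'))) \<le> c"
proof -
  interpret M: prob_space M by fact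
  interpret P: prob_space "sample_space M n" by (intro prob_space_PiM M.prob_space_axioms)
  have le: "ereal (norm (A (x(k := y)) - A (x(k := y')))) \<le> hyp_sens M n A"
    if "x \<in> space (sample_space M n)" "k < n" "y \<in> space M" "y' \<in> space M" for x k y y'
    unfolding hyp_sens_def using that
    by (intro SUP_upper2[of k] SUP_upper2[of x] SUP_upper2[of y] SUP_upper2[of y']) auto
  obtain y where "y \<in> space M" using M.not_empty by auto
  moreover obtain x where "x \<in> space (sample_space M n)" using P.not_empty by blast
  ultimately have nonneg: "0 \<le> hyp_sens M n A"
    using le[of x 0 y y] n by (simp add: zero_ereal_def)
  obtain c where c: "hyp_sens M n A = ereal c" "0 \<le> c"
  proof (cases "hyp_sens M n A")
    case PInf
    with sens n show ?thesis by (simp add: power2_eq_square)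
  qed (use nonneg that in auto)
  show thesis
  proof (rule that)
    show "12 * real n * c\<^sup>2 \<le> \<sigma>\<^sup>2" using sens c by simp
  qed (use c le in auto)
qed

locale gauss_randomization = prob_space M
  for M :: "'x measure" +
  fixes n :: nat and f :: "'h::euclidean_space \<Rightarrow> 'x \<Rightarrow> real"
    and A :: "(nat \<Rightarrow> 'x) \<Rightarrow> 'h" and \<sigma> :: real
  assumes n: "n \<ge> 1"
    and f_meas [measurable]: "(\<lambda>(h, x). f h x) \<in> borel_measurable (lborel \<Otimes>\<^sub>M M)"
    and f_range: "\<And>h x. x \<in> space M \<Longrightarrow> 0 \<le> f h x \<and> f h x \<le> 1"
    and A_meas [measurable]: "A \<in> borel_measurable (sample_space M n)"
    and \<sigma>: "\<sigma> > 0"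
    and sens: "ereal (12 * real n) * (hyp_sens M n A)\<^sup>2 \<le> ereal (\<sigma>\<^sup>2)"
begin

definition Q :: "(nat \<Rightarrow> 'x) \<Rightarrow> 'h measure" where
  "Q = gibbs (\<lambda>h xs. - (norm (h - A xs))\<^sup>2 / (2 * \<sigma>\<^sup>2))"

abbreviation "V \<equiv> var_alg M n A"

sublocale P: prob_space "sample_space M n"
  by (intro prob_space_PiM prob_space_axioms)

lemma Q_eq: "Q xs = density lborel (\<lambda>h. ennreal (gauss_density \<sigma> (A xs) h))"
  unfolding Q_def by (rule gibbs_eq_gauss[OF \<sigma>])

lemma sets_Q [measurable_cong, simp]: "sets (Q xs) = sets borel"
  by (simp add: Q_eq)

lemma space_Q [simp]: "space (Q xs) = UNIV"
  by (simp add: Q_eq)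

lemma prob_space_Q: "prob_space (Q xs)"
  by (rule prob_spaceI) (simp add: Q_eq emeasure_density nn_integral_gauss_density[OF \<sigma>])

section \<open>Measurability and range of the losses\<close>

lemma nn_integral_Q_measurable [measurable]:
  assumes [measurable]: "(\<lambda>(h, xs). G h xs) \<in> borel_measurable (lborel \<Otimes>\<^sub>M sample_space M n)"
  shows "(\<lambda>xs. \<integral>\<^sup>+ h. G h xs \<partial>Q xs) \<in> borel_measurable (sample_space M n)"
proof -
  have "(\<integral>\<^sup>+ h. G h xs \<partial>Q xs) = (\<integral>\<^sup>+ h. ennreal (gauss_density \<sigma> (A xs) h) * G h xs \<partial>lborel)"
    if "xs \<in> space (sample_space M n)" for xs
    using that unfolding Q_eq by (intro nn_integral_density) measurable
  then show ?thesis by (subst measurable_cong) measurable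
qed

lemma var_alg_nonneg: "0 \<le> V"
  unfolding var_alg_def by simp

lemma f_section [measurable]: "f h \<in> borel_measurable M"
proof -
  have "(\<lambda>x. (\<lambda>(h, x). f h x) (h, x)) \<in> borel_measurable M" by measurable
  then show ?thesis by simp
qed

lemma exp_loss_measurable [measurable]: "exp_loss M f \<in> borel_measurable borel"
proof -
  have "(\<lambda>h. \<integral>x. f h x \<partial>M) \<in> borel_measurable lborel" by measurable
  then show ?thesis by (simp add: exp_loss_def [abs_def])
qed

lemma var_h_measurable [measurable]: "var_h M f \<in> borel_measurable borel"
proof -
  have "(\<lambda>h. \<integral>x. (f h x - exp_loss M f h)\<^sup>2 \<partial>M) \<in> borel_measurable lborel" by measurable
  then show ?thesis by (simp add: var_h_def [abs_def])
qed

lemma emp_loss_measurable [measurable]: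
  "(\<lambda>(h, xs). emp_loss n f h xs) \<in> borel_measurable (lborel \<Otimes>\<^sub>M sample_space M n)"
  unfolding emp_loss_def by measurable

lemma gen_gap_measurable [measurable]:
  "(\<lambda>(h, xs). gen_gap M n f h xs) \<in> borel_measurable (lborel \<Otimes>\<^sub>M sample_space M n)"
  unfolding gen_gap_def by measurable

lemma gen_gap_section [measurable]:
  assumes "xs \<in> space (sample_space M n)"
  shows "(\<lambda>h. gen_gap M n f h xs) \<in> borel_measurable borel"
proof -
  have "(\<lambda>h. (\<lambda>(h, xs). gen_gap M n f h xs) (h, xs)) \<in> borel_measurable lborel"
    using assms by measurable
  then show ?thesis by simp
qed

lemma exp_loss_range: "0 \<le> exp_loss M f h" "exp_loss M f h \<le> 1"
proof -
  have "integrable M (f h)" using f_range by (intro integrable_const_bound[where B = 1]) auto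
  then show "0 \<le> exp_loss M f h" "exp_loss M f h \<le> 1"
    using f_range by (auto simp: exp_loss_def intro!: integral_nonneg_AE integral_le_const)
qed

lemma emp_loss_range:
  assumes "xs \<in> space (sample_space M n)"
  shows "0 \<le> emp_loss n f h xs" "emp_loss n f h xs \<le> 1"
proof -
  have xs: "xs i \<in> space M" if "i < n" for i using assms that by (auto simp: space_PiM)
  show "0 \<le> emp_loss n f h xs"
    unfolding emp_loss_def using f_range xs by (intro divide_nonneg_nonneg sum_nonneg) auto
  have "(\<Sum>i<n. f h (xs i)) \<le> real n"
    using f_range xs sum_bounded_above[of "{..<n}" "\<lambda>i. f h (xs i)" 1] by auto
  then show "emp_loss n f h xs \<le> 1" using n by (simp add: emp_loss_def)
qed

text \<open>The distance of A to its mean inherits bounded differences from A. Its range is bounded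
  by n c: any two values of A differ by at most that, and so does a value from the average of all
  values.\<close>

lemma nn_integral_exp_deviation_le:
  "(\<integral>\<^sup>+ xs. exp ((norm (A xs - (\<integral>ys. A ys \<partial>sample_space M n)))\<^sup>2 / \<sigma>\<^sup>2) \<partial>sample_space M n) \<le> exp (3 / \<sigma>\<^sup>2 * V)"
proof -
  obtain c where c: "0 \<le> c" "12 * real n * c\<^sup>2 \<le> \<sigma>\<^sup>2"
    and diff: "\<And>x k y y'. x \<in> space (sample_space M n) \<Longrightarrow> k < n \<Longrightarrow> y \<in> space M \<Longrightarrow> y' \<in> space M
      \<Longrightarrow> norm (A (x(k := y)) - A (x(k := y'))) \<le> c"
    using hyp_sens_bound[OF prob_space_axioms n sens] by metis
  have diameter: "norm (A x - A x') \<le> real n * c"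
    if x: "x \<in> space (sample_space M n)" and x': "x' \<in> space (sample_space M n)" for x x'
  proof -
    \<comment> \<open>Hybrid points: the first k coordinates come from x', the others from x, so
      consecutive points differ in one coordinate.\<close>
    define z where "z = (\<lambda>k i. if i < k then x' i else x i)"
    have z_space: "z k \<in> space (sample_space M n)" if "k \<le> n" for k
      using x x' that by (auto simp: z_def space_PiM PiE_iff extensional_def)
    have "norm (A x - A (z k)) \<le> real k * c" if "k \<le> n" for k
      using that
    proof (induction k)
      case (Suc k)
      have z_eq: "(z k)(k := x' k) = z (Suc k)" "(z k)(k := x k) = z k"
        by (rule ext, simp add: z_def)+
      have "x k \<in> space M" "x' k \<in> space M"
        using PiE_mem[OF x[unfolded space_PiM], of k] PiE_mem[OF x'[unfolded space_PiM], of k] Suc.prems by simp_all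
      then have "norm (A ((z k)(k := x k)) - A ((z k)(k := x' k))) \<le> c"
        using z_space[of k] Suc.prems by (intro diff) auto
      then have "norm (A (z k) - A (z (Suc k))) \<le> c" unfolding z_eq .
      moreover have "norm (A x - A (z (Suc k))) \<le> norm (A x - A (z k)) + norm (A (z k) - A (z (Suc k)))"
        using norm_triangle_ineq[of "A x - A (z k)" "A (z k) - A (z (Suc k))"] by simp
      ultimately show ?case using Suc by (simp add: algebra_simps)
    qed (simp add: z_def)
    moreover have "z n = x'"
      using x x' by (auto simp: z_def fun_eq_iff space_PiM PiE_iff extensional_def)
    ultimately show ?thesis by (metis order_refl)
  qed
  obtain x0 where x0: "x0 \<in> space (sample_space M n)" using P.not_empty by blast
  have int_A: "integrable (sample_space M n) A"
  proof (rule P.integrable_const_bound[where B = "norm (A x0) + real n * c"])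
    show "AE x in sample_space M n. norm (A x) \<le> norm (A x0) + real n * c"
    proof (rule AE_I2)
      fix x assume "x \<in> space (sample_space M n)"
      then show "norm (A x) \<le> norm (A x0) + real n * c"
        using diameter[of x x0] x0 norm_triangle_sub[of "A x" "A x0"] by auto
    qed
  qed measurable
  define m where "m = (\<integral>ys. A ys \<partial>sample_space M n)"
  define g where "g = (\<lambda>xs. norm (A xs - m))"
  have g_range: "0 \<le> g x \<and> g x \<le> real n * c" if x: "x \<in> space (sample_space M n)" for x
  proof -
    have "A x - m = (\<integral>ys. A x - A ys \<partial>sample_space M n)"
      using int_A by (simp add: m_def P.prob_space)
    also have "norm \<dots> \<le> (\<integral>ys. norm (A x - A ys) \<partial>sample_space M n)"
      by (rule integral_norm_bound)
    also have "\<dots> \<le> real n * c"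
      using int_A diameter[OF x] by (intro P.integral_le_const) auto
    finally show ?thesis by (simp add: g_def)
  qed
  have "real n * c\<^sup>2 / \<sigma>\<^sup>2 \<le> 1 / 12" using c \<sigma> by (simp add: field_simps)
  note nc = this
  have e: "(1 + 1 / real n) ^ n \<le> 3"
    using exp_ge_one_plus_x_over_n_power_n[of n 1] n exp_le by linarith
  have "(\<integral>\<^sup>+ xs. exp (1 / \<sigma>\<^sup>2 * (g xs)\<^sup>2) \<partial>sample_space M n)
    \<le> exp (1 / \<sigma>\<^sup>2 * (1 + 1 / real n) ^ card {..<n} * (\<integral>xs. (g xs)\<^sup>2 \<partial>sample_space M n))"
  \<comment> \<open>With \<theta> = 1/n the condition 4 b c^2 <= \<theta> is exactly the sensitivity
    hypothesis for c, and 2 b c B = 6 n c^2 / \<sigma>^2 is at most 1/2.\<close>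
  proof (rule nn_integral_exp_square_bounded_differences_le[where b = "3 / \<sigma>\<^sup>2" and c = c and B = "real n * c"])
    show "\<bar>g (x(k := y)) - g (x(k := y'))\<bar> \<le> c"
      if "x \<in> space (sample_space M n)" "k \<in> {..<n}" "y \<in> space M" "y' \<in> space M" for x k y y'
      using diff[of x k y y'] that norm_triangle_ineq3[of "A (x(k := y)) - m" "A (x(k := y')) - m"]
      unfolding g_def by auto
    show "1 / \<sigma>\<^sup>2 * (1 + 1 / real n) ^ card {..<n} \<le> 3 / \<sigma>\<^sup>2"
      using e by (simp add: divide_right_mono)
    show "4 * (3 / \<sigma>\<^sup>2) * c\<^sup>2 \<le> 1 / real n" using nc n by (simp add: field_simps)
    have "2 * (3 / \<sigma>\<^sup>2) * c * (real n * c) = 6 * (real n * c\<^sup>2 / \<sigma>\<^sup>2)" by (simp add: power2_eq_square)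
    then show "2 * (3 / \<sigma>\<^sup>2) * c * (real n * c) \<le> 1" using nc by linarith
  qed (use g_range c in \<open>auto simp: g_def\<close>)
  also have "\<dots> \<le> exp (3 / \<sigma>\<^sup>2 * V)"
  proof -
    have V: "(\<integral>xs. (g xs)\<^sup>2 \<partial>sample_space M n) = V" by (simp add: g_def m_def var_alg_def)
    have "1 / \<sigma>\<^sup>2 * (1 + 1 / real n) ^ card {..<n} * V \<le> 3 / \<sigma>\<^sup>2 * V"
      using e var_alg_nonneg by (intro mult_right_mono) (auto simp: divide_right_mono)
    then show ?thesis unfolding V by (intro ennreal_leI) simp
  qed
  finally show ?thesis by (simp add: g_def m_def)
qed

lemma nn_integral_Q_le:
  fixes G :: "'h \<Rightarrow> (nat \<Rightarrow> 'x) \<Rightarrow> ennreal"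
  assumes [measurable]: "(\<lambda>(h, xs). G h xs) \<in> borel_measurable (lborel \<Otimes>\<^sub>M sample_space M n)"
    and G_le: "\<And>h. (\<integral>\<^sup>+ xs. (G h xs)\<^sup>2 \<partial>sample_space M n) \<le> ennreal (K\<^sup>2)" and K: "0 \<le> K"
  shows "(\<integral>\<^sup>+ xs. (\<integral>\<^sup>+ h. G h xs \<partial>Q xs) \<partial>sample_space M n) \<le> ennreal (K * exp (3 / \<sigma>\<^sup>2 * V))"
    (is "?E \<le> _")
proof -
  have "?E\<^sup>2 \<le> ennreal (K\<^sup>2) * (\<integral>\<^sup>+ xs. exp ((norm (A xs - (\<integral>ys. A ys \<partial>sample_space M n)))\<^sup>2 / \<sigma>\<^sup>2) \<partial>sample_space M n)"
    unfolding Q_eq by (intro P.gauss_change_of_measure \<sigma> G_le) measurable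
  also have "\<dots> \<le> ennreal (K\<^sup>2) * ennreal (exp (3 / \<sigma>\<^sup>2 * V))"
    by (intro mult_left_mono nn_integral_exp_deviation_le) simp
  \<comment> \<open>The square root still to be taken would halve the exponent; doubling it here
    gives a perfect square with the constant 3.\<close>
  also have "\<dots> \<le> ennreal (K\<^sup>2) * ennreal (exp (2 * (3 / \<sigma>\<^sup>2 * V)))"
    using var_alg_nonneg by (intro mult_left_mono ennreal_leI) (auto intro!: divide_right_mono)
  also have "\<dots> = ennreal ((K * exp (3 / \<sigma>\<^sup>2 * V))\<^sup>2)"
    by (simp only: exp_double power_mult_distrib) (simp add: ennreal_mult')
  finally have sq: "?E\<^sup>2 \<le> ennreal ((K * exp (3 / \<sigma>\<^sup>2 * V))\<^sup>2)" .
  then show ?thesis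
  proof (cases ?E)
    case (real r)
    with sq have "r\<^sup>2 \<le> (K * exp (3 / \<sigma>\<^sup>2 * V))\<^sup>2" by (simp add: ennreal_power)
    then have "r \<le> K * exp (3 / \<sigma>\<^sup>2 * V)" by (rule power2_le_imp_le) (use K in simp)
    with real show ?thesis by (simp add: ennreal_leI)
  next
    case top
    with sq show ?thesis by (simp add: top_unique)
  qed
qed

text \<open>Markov's inequality for the joint law, written with iterated integrals: pointwise, the
  indicator of F <= W plus exp (F - W) is at least 1, and the second term integrates to at most
  \<delta>. The 2 in \<open>F_le\<close> comes from Cauchy-Schwarz.\<close>

lemma Q_deviation_bound:
  fixes F :: "'h \<Rightarrow> (nat \<Rightarrow> 'x) \<Rightarrow> real" and \<delta> :: real
  assumes F [measurable]: "(\<lambda>(h, xs). F h xs) \<in> borel_measurable (lborel \<Otimes>\<^sub>M sample_space M n)"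
    and F_le: "\<And>h. (\<integral>\<^sup>+ xs. exp (2 * F h xs) \<partial>sample_space M n) \<le> 1" and \<delta>: "0 < \<delta>"
    and S: "\<And>xs. xs \<in> space (sample_space M n) \<Longrightarrow> S xs \<in> sets borel"
    and S_sup: "\<And>h xs. xs \<in> space (sample_space M n) \<Longrightarrow> F h xs \<le> 3 / \<sigma>\<^sup>2 * V + ln (1 / \<delta>) \<Longrightarrow> h \<in> S xs"
  shows "(\<integral>\<^sup>+ xs. emeasure (Q xs) (S xs) \<partial>sample_space M n) \<ge> ennreal (1 - \<delta>)"
proof (rule ennreal_one_minus_le)
  define W where "W = 3 / \<sigma>\<^sup>2 * V + ln (1 / \<delta>)"
  have [measurable]: "(\<lambda>h. F h xs) \<in> borel_measurable borel" if "xs \<in> space (sample_space M n)" for xs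
  proof -
    have "(\<lambda>h. (\<lambda>(h, xs). F h xs) (h, xs)) \<in> borel_measurable lborel" using that by measurable
    then show ?thesis by simp
  qed
  \<comment> \<open>Additivity of the integral over samples calls for measurability in
    \<open>xs\<close>, which joint measurability of F provides for J; passing from J to the measure
    of \<open>S xs\<close> is mere monotonicity.\<close>
  define J where "J = (\<lambda>xs. \<integral>\<^sup>+ h. (if F h xs \<le> W then 1 else 0) \<partial>Q xs)"
  define E where "E = (\<lambda>xs. \<integral>\<^sup>+ h. ennreal (exp (F h xs)) \<partial>Q xs)"
  have [measurable]: "J \<in> borel_measurable (sample_space M n)" "E \<in> borel_measurable (sample_space M n)"
    unfolding J_def E_def by measurable
  have J_le: "J xs \<le> emeasure (Q xs) (S xs)" if xs: "xs \<in> space (sample_space M n)" for xs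
  proof -
    have "J xs \<le> (\<integral>\<^sup>+ h. indicator (S xs) h \<partial>Q xs)"
      unfolding J_def using S_sup[OF xs] by (intro nn_integral_mono) (auto simp: W_def indicator_def)
    then show ?thesis using S[OF xs] by simp
  qed
  have one_le: "1 \<le> J xs + ennreal (exp (- W)) * E xs" if xs: "xs \<in> space (sample_space M n)" for xs
  proof -
    interpret Q: prob_space "Q xs" by (rule prob_space_Q)
    have "1 = (\<integral>\<^sup>+ h. 1 \<partial>Q xs)" using Q.emeasure_space_1 by simp
    also have "\<dots> \<le> (\<integral>\<^sup>+ h. (if F h xs \<le> W then 1 else 0) + ennreal (exp (- W)) * ennreal (exp (F h xs)) \<partial>Q xs)"
    proof (intro nn_integral_mono)
      fix h
      show "1 \<le> (if F h xs \<le> W then 1 else 0) + ennreal (exp (- W)) * ennreal (exp (F h xs))"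
      proof (cases "F h xs \<le> W")
        case False
        then have "ennreal 1 \<le> ennreal (exp (- W + F h xs))" by (intro ennreal_leI) simp
        with False show ?thesis by (simp only: exp_add ennreal_mult' exp_ge_zero) simp
      qed simp
    qed
    also have "\<dots> = J xs + ennreal (exp (- W)) * E xs"
      unfolding J_def E_def using xs by (simp add: nn_integral_add nn_integral_cmult)
    finally show ?thesis .
  qed
  have E_le: "(\<integral>\<^sup>+ xs. E xs \<partial>sample_space M n) \<le> ennreal (1 * exp (3 / \<sigma>\<^sup>2 * V))"
    unfolding E_def using F_le by (intro nn_integral_Q_le) (auto simp: ennreal_power exp_double)
  have "1 = (\<integral>\<^sup>+ xs. 1 \<partial>sample_space M n)" by (simp add: P.emeasure_space_1)
  also have "\<dots> \<le> (\<integral>\<^sup>+ xs. J xs + ennreal (exp (- W)) * E xs \<partial>sample_space M n)"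
    by (intro nn_integral_mono one_le)
  also have "\<dots> = (\<integral>\<^sup>+ xs. J xs \<partial>sample_space M n) + ennreal (exp (- W)) * (\<integral>\<^sup>+ xs. E xs \<partial>sample_space M n)"
    by (simp add: nn_integral_add nn_integral_cmult)
  also have "\<dots> \<le> (\<integral>\<^sup>+ xs. emeasure (Q xs) (S xs) \<partial>sample_space M n) + ennreal (exp (- W)) * ennreal (1 * exp (3 / \<sigma>\<^sup>2 * V))"
    by (intro add_mono mult_left_mono nn_integral_mono J_le E_le) auto
  also have "ennreal (exp (- W)) * ennreal (1 * exp (3 / \<sigma>\<^sup>2 * V)) = ennreal \<delta>"
    using \<delta> by (simp add: ennreal_mult' [symmetric] exp_add [symmetric] W_def ln_div)
  finally show "1 \<le> (\<integral>\<^sup>+ xs. emeasure (Q xs) (S xs) \<partial>sample_space M n) + ennreal \<delta>" .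
qed (use \<delta> in simp)

section \<open>Deviations of the generalization gap\<close>

lemma nn_integral_exp_gen_gap_le:
  assumes "(\<integral>\<^sup>+ x. exp (2 * l / real n * (exp_loss M f h - f h x)) \<partial>M) \<le> ennreal (exp (2 * b / real n))"
  shows "(\<integral>\<^sup>+ xs. exp (2 * (l * gen_gap M n f h xs - b)) \<partial>sample_space M n) \<le> 1"
proof -
  have "(\<integral>\<^sup>+ xs. exp (2 * (l * gen_gap M n f h xs - b)) \<partial>sample_space M n)
    = (\<integral>\<^sup>+ xs. ennreal (exp (- 2 * b)) * ennreal (exp (2 * l * (expectation (f h) - (\<Sum>i<n. f h (xs i)) / real n))) \<partial>sample_space M n)"
    by (intro nn_integral_cong)
       (simp add: ennreal_mult' [symmetric] exp_add [symmetric] gen_gap_def exp_loss_def emp_loss_def algebra_simps)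
  also have "\<dots> = ennreal (exp (- 2 * b)) * (\<integral>\<^sup>+ xs. ennreal (exp (2 * l * (expectation (f h) - (\<Sum>i<n. f h (xs i)) / real n))) \<partial>sample_space M n)"
    by (intro nn_integral_cmult) measurable
  also have "\<dots> \<le> ennreal (exp (- 2 * b)) * ennreal (exp (real n * (2 * b / real n)))"
    using assms n by (intro mult_left_mono nn_integral_exp_gap_le) (auto simp: exp_loss_def)
  also have "\<dots> = 1"
    using n by (simp add: ennreal_mult' [symmetric] exp_add [symmetric])
  finally show ?thesis .
qed

lemma hoeffding_deviation:
  assumes \<delta>: "0 < \<delta>" "\<delta> < 1"
  defines "W \<equiv> 3 / \<sigma>\<^sup>2 * V + ln (1 / \<delta>)"
  shows "(\<integral>\<^sup>+ xs. emeasure (Q xs) {h \<in> space (Q xs). gen_gap M n f h xs \<le> sqrt (W / real n)} \<partial>sample_space M n) \<ge> ennreal (1 - \<delta>)"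
proof -
  have n0: "real n > 0" using n by simp
  have W: "W > 0"
    using \<delta> var_alg_nonneg \<sigma> unfolding W_def by (intro add_nonneg_pos) auto
  \<comment> \<open>This l minimises the resulting bound W/l + l/(4 n) on the gap; the minimum is
    sqrt (W/n).\<close>
  define l where "l = 2 * sqrt (real n * W)"
  have l: "l > 0" "l\<^sup>2 = 4 * (real n * W)" using W n0 by (auto simp: l_def power_mult_distrib)
  show ?thesis
  proof (rule Q_deviation_bound[where F = "\<lambda>h xs. l * gen_gap M n f h xs - l\<^sup>2 / (4 * real n)"])
    show "(\<lambda>(h, xs). l * gen_gap M n f h xs - l\<^sup>2 / (4 * real n)) \<in> borel_measurable (lborel \<Otimes>\<^sub>M sample_space M n)"
      by measurable
    show "(\<integral>\<^sup>+ xs. exp (2 * (l * gen_gap M n f h xs - l\<^sup>2 / (4 * real n))) \<partial>sample_space M n) \<le> 1" for h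
    proof (rule nn_integral_exp_gen_gap_le)
      have "(\<integral>\<^sup>+ x. exp (2 * l / real n * (exp_loss M f h - f h x)) \<partial>M) \<le> ennreal (exp ((2 * l / real n)\<^sup>2 / 8))"
        unfolding exp_loss_def using l n0 f_range by (intro nn_integral_exp_hoeffding_le) auto
      also have "(2 * l / real n)\<^sup>2 / 8 = 2 * (l\<^sup>2 / (4 * real n)) / real n"
        by (simp add: power2_eq_square)
      finally show "(\<integral>\<^sup>+ x. exp (2 * l / real n * (exp_loss M f h - f h x)) \<partial>M)
        \<le> ennreal (exp (2 * (l\<^sup>2 / (4 * real n)) / real n))" .
    qed
    fix h xs assume "l * gen_gap M n f h xs - l\<^sup>2 / (4 * real n) \<le> 3 / \<sigma>\<^sup>2 * V + ln (1 / \<delta>)"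
    then have "l * gen_gap M n f h xs - l\<^sup>2 / (4 * real n) \<le> W" by (simp only: W_def)
    then have "l * gen_gap M n f h xs \<le> 2 * W" using n0 by (simp add: l)
    also have "2 * W = l * sqrt (W / real n)"
      using W n0 by (simp add: l_def real_sqrt_mult real_sqrt_divide)
    finally show "h \<in> {h \<in> space (Q xs). gen_gap M n f h xs \<le> sqrt (W / real n)}" using l by simp
  qed (use \<delta> in auto)
qed

lemma bernstein_deviation:
  assumes \<delta>: "0 < \<delta>" "\<delta> < 1"
  defines "W \<equiv> 3 / \<sigma>\<^sup>2 * V + ln (1 / \<delta>)"
  shows "(\<integral>\<^sup>+ xs. emeasure (Q xs) {h \<in> space (Q xs). gen_gap M n f h xs
    \<le> 2 * sqrt (var_h M f h * (W / real n)) + W / real n} \<partial>sample_space M n) \<ge> ennreal (1 - \<delta>)"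
proof -
  have n0: "real n > 0" using n by simp
  have W: "W > 0"
    using \<delta> var_alg_nonneg \<sigma> unfolding W_def by (intro add_nonneg_pos) auto
  define w where "w = W / real n"
  have w: "w > 0" using W n0 by (simp add: w_def)
  \<comment> \<open>\<open>t\<close> minimises \<open>2 w / t + v t / (2 (1 - t / 2))\<close>. The moment bound has \<open>1 - t / 3\<close> instead, which keeps
    it valid at \<open>t = 2\<close>, the value attained when \<open>v = 0\<close>.\<close>
  define s where "s = (\<lambda>h. sqrt (var_h M f h / (4 * w)))"
  define t where "t = (\<lambda>h. 1 / (1 / 2 + s h))"
  define b where "b = (\<lambda>h. real n / 2 * ((t h)\<^sup>2 / (2 * (1 - t h / 3)) * var_h M f h))"
  have v0: "0 \<le> var_h M f h" for h by (simp add: var_h_def)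
  have s0: "0 \<le> s h" for h using v0 w by (simp add: s_def)
  have t: "0 < t h" "t h \<le> 2" "t h * (1 / 2 + s h) = 1" for h
    using s0[of h] by (auto simp: t_def field_simps)
  \<comment> \<open>The parameter may vary with h, since the moment bound is required for each h
    separately; only F must be jointly measurable.\<close>
  have [measurable]: "t \<in> borel_measurable borel" "b \<in> borel_measurable borel"
    unfolding b_def t_def s_def by measurable
  show ?thesis
  proof (rule Q_deviation_bound[where F = "\<lambda>h xs. real n * t h / 2 * gen_gap M n f h xs - b h"])
    show "(\<lambda>(h, xs). real n * t h / 2 * gen_gap M n f h xs - b h) \<in> borel_measurable (lborel \<Otimes>\<^sub>M sample_space M n)"
      by measurable
    show "(\<integral>\<^sup>+ xs. exp (2 * (real n * t h / 2 * gen_gap M n f h xs - b h)) \<partial>sample_space M n) \<le> 1" for h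
    proof (rule nn_integral_exp_gen_gap_le)
      have "2 * (real n * t h / 2) / real n = t h" using n0 by simp
      moreover have "2 * (real n / 2 * c) / real n = c" for c using n0 by simp
      then have "2 * b h / real n = (t h)\<^sup>2 / (2 * (1 - t h / 3)) * var_h M f h"
        unfolding b_def .
      ultimately show "(\<integral>\<^sup>+ x. exp (2 * (real n * t h / 2) / real n * (exp_loss M f h - f h x)) \<partial>M) \<le> ennreal (exp (2 * b h / real n))"
        using nn_integral_exp_bernstein_le[of "f h" "t h"] t[of h] f_range
        by (simp add: exp_loss_def var_h_def)
    qed
    fix h xs assume "real n * t h / 2 * gen_gap M n f h xs - b h \<le> 3 / \<sigma>\<^sup>2 * V + ln (1 / \<delta>)"
    then have "real n * t h / 2 * gen_gap M n f h xs - b h \<le> real n * w"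
      using n0 by (simp add: w_def W_def)
    then have "real n * (t h * gen_gap M n f h xs) \<le> real n * (2 * w + (t h)\<^sup>2 / (2 * (1 - t h / 3)) * var_h M f h)"
    proof -
      have "real n * (t h * g) \<le> real n * (2 * w + d)" if "real n * t h / 2 * g - real n / 2 * d \<le> real n * w" for g d
        using that by (simp add: algebra_simps)
      then show ?thesis using \<open>_ \<le> real n * w\<close> unfolding b_def .
    qed
    then have "t h * gen_gap M n f h xs \<le> 2 * w + (t h)\<^sup>2 / (2 * (1 - t h / 3)) * var_h M f h"
      using n0 by (simp only: mult_le_cancel_left_pos)
    also have "(t h)\<^sup>2 / (2 * (1 - t h / 3)) * var_h M f h \<le> t h * sqrt (var_h M f h * w)"
    proof (cases "var_h M f h = 0")
      case False
      define r where "r = sqrt (var_h M f h * w)"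
      have v: "var_h M f h > 0" using False v0[of h] by simp
      then have sh: "s h > 0" using w by (simp add: s_def)
      have "s h * r = sqrt ((var_h M f h / 2)\<^sup>2)"
        unfolding s_def r_def using w by (simp add: real_sqrt_mult [symmetric] power2_eq_square field_simps)
      then have sr: "s h * r = var_h M f h / 2" using v by simp
      \<comment> \<open>Replacing 1 - t/3 by the smaller t s enlarges the fraction and reduces it to
        t v / (2 s), which equals t r because s r = v/2.\<close>
      have "t h * s h = 1 - t h / 2" using t(3)[of h] by (simp add: algebra_simps)
      then have ts: "t h * s h \<le> 1 - t h / 3" "0 < t h * s h" using t[of h] sh mult_pos_pos[of "t h" "s h"] by auto
      have "(t h)\<^sup>2 / (2 * (1 - t h / 3)) * var_h M f h \<le> (t h)\<^sup>2 / (2 * (t h * s h)) * var_h M f h"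
        using ts v t[of h] by (intro mult_right_mono divide_left_mono) auto
      also have "\<dots> = t h * (var_h M f h / 2) / s h"
        using t[of h] sh by (simp add: power2_eq_square field_simps)
      also have "\<dots> = t h * r" using sh unfolding sr [symmetric] by simp
      finally show ?thesis by (simp add: r_def)
    qed simp
    \<comment> \<open>Every term is given the factor \<open>t h\<close>, which is positive and
      cancels at the end.\<close>
    also have "2 * w = t h * (2 * w * (1 / 2 + s h))"
    proof -
      have "t h * (2 * w * (1 / 2 + s h)) = 2 * w * (t h * (1 / 2 + s h))" by (simp only: mult_ac)
      then show ?thesis by (simp only: t(3) mult_1_right)
    qed
    also have "2 * w * (1 / 2 + s h) = w + sqrt (var_h M f h * w)"
    proof -
      have "2 * w * s h = sqrt ((2 * w)\<^sup>2 * (var_h M f h / (4 * w)))"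
      proof -
        have "sqrt ((2 * w)\<^sup>2) = 2 * w" using w by (intro real_sqrt_unique) auto
        then show ?thesis by (simp only: s_def real_sqrt_mult)
      qed
      also have "(2 * w)\<^sup>2 * (var_h M f h / (4 * w)) = var_h M f h * w"
        using w by (simp add: power2_eq_square)
      finally show ?thesis by (simp add: algebra_simps)
    qed
    also have "t h * (w + sqrt (var_h M f h * w)) + t h * sqrt (var_h M f h * w)
      = t h * (2 * sqrt (var_h M f h * w) + w)" by (simp add: algebra_simps)
    finally show "h \<in> {h \<in> space (Q xs). gen_gap M n f h xs \<le> 2 * sqrt (var_h M f h * (W / real n)) + W / real n}"
      using t(1)[of h] by (simp add: w_def [symmetric])
  qed (use \<delta> in auto)
qed

section \<open>Relative entropy of empirical and expected loss\<close>

definition kl_moment :: "(nat \<Rightarrow> 'x) \<Rightarrow> ennreal" where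
  "kl_moment xs = (\<integral>\<^sup>+ h. eexp (ereal (real n / 2) * kl (emp_loss n f h xs) (exp_loss M f h)) \<partial>Q xs)"

lemma kl_moment_measurable [measurable]: "kl_moment \<in> borel_measurable (sample_space M n)"
  unfolding kl_moment_def by measurable

lemma kl_moment_bound:
  assumes "n > 8"
  shows "(\<integral>\<^sup>+ xs. kl_moment xs \<partial>sample_space M n) \<le> ennreal (exp (3 / \<sigma>\<^sup>2 * V + ln (2 * sqrt (real n)) / 2))"
proof -
  have "(\<integral>\<^sup>+ xs. kl_moment xs \<partial>sample_space M n) \<le> ennreal (sqrt (2 * sqrt (real n)) * exp (3 / \<sigma>\<^sup>2 * V))"
    unfolding kl_moment_def
  proof (rule nn_integral_Q_le)
    fix h
    have "2 * (ereal (real n / 2) * z) = ereal (real n) * z" for z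
    proof -
      have "2 * ereal (real n / 2) = ereal (real n)" by simp
      then show ?thesis by (simp flip: mult.assoc)
    qed
    then have "(\<integral>\<^sup>+ xs. (eexp (ereal (real n / 2) * kl (emp_loss n f h xs) (exp_loss M f h)))\<^sup>2 \<partial>sample_space M n)
      = (\<integral>\<^sup>+ xs. eexp (ereal (real n) * kl ((\<Sum>i<n. f h (xs i)) / real n) (expectation (f h))) \<partial>sample_space M n)"
      by (simp add: eexp_square emp_loss_def exp_loss_def)
    also have "\<dots> \<le> ennreal (2 * sqrt (real n))"
      using assms f_range by (intro nn_integral_exp_kl_le) auto
    finally show "(\<integral>\<^sup>+ xs. (eexp (ereal (real n / 2) * kl (emp_loss n f h xs) (exp_loss M f h)))\<^sup>2 \<partial>sample_space M n)
      \<le> ennreal ((sqrt (2 * sqrt (real n)))\<^sup>2)" by simp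
    show "(\<lambda>(h, xs). eexp (ereal (real n / 2) * kl (emp_loss n f h xs) (exp_loss M f h)))
      \<in> borel_measurable (lborel \<Otimes>\<^sub>M sample_space M n)" by measurable
  qed simp
  \<comment> \<open>The square root from Cauchy-Schwarz becomes the factor 1/2 of the
    logarithm.\<close>
  also have "sqrt (2 * sqrt (real n)) = exp (ln (2 * sqrt (real n)) / 2)"
    using n by (simp add: ln_sqrt [symmetric])
  finally show ?thesis by (simp add: exp_add mult.commute)
qed

text \<open>Markov's inequality makes \<open>kl_moment\<close> at most exp b outside an event of
  probability \<delta>. On the remaining samples the average of (n/2) kl over h is at most b, as
  Jensen's inequality suggests.\<close>

lemma kl_deviation:
  assumes n8: "n > 8" and \<delta>: "0 < \<delta>" "\<delta> < 1"
  shows "emeasure (sample_space M n)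
        {xs \<in> space (sample_space M n).
           (\<integral>\<^sup>+ h. e2ennreal (kl (emp_loss n f h xs) (exp_loss M f h)) \<partial>Q xs)
             \<le> ennreal ((6 / \<sigma>\<^sup>2 * V + ln (2 * sqrt (real n)) + 2 * ln (1 / \<delta>)) / real n)}
        \<ge> ennreal (1 - \<delta>)" (is "emeasure _ ?S \<ge> _")
proof (rule ennreal_one_minus_le)
  define C where "C = 3 / \<sigma>\<^sup>2 * V + ln (2 * sqrt (real n)) / 2"
  define b where "b = C + ln (1 / \<delta>)"
  have n0: "real n > 0" using n by simp
  have "sqrt (real n) \<ge> 1" using n by simp
  then have sqrt_n: "2 * sqrt (real n) \<ge> 1" by linarith
  \<comment> \<open>A negative b would be truncated to 0 by \<open>ennreal\<close>.\<close>
  have b0: "b \<ge> 0"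
    unfolding b_def C_def using \<delta> var_alg_nonneg \<sigma> sqrt_n by (intro add_nonneg_nonneg) auto
  have [measurable]: "?S \<in> sets (sample_space M n)" by measurable
  have in_S: "xs \<in> ?S" if xs: "xs \<in> space (sample_space M n)" and le: "ennreal (exp (- b)) * kl_moment xs \<le> 1" for xs
  proof -
    interpret Q: prob_space "Q xs" by (rule prob_space_Q)
    let ?kl = "\<lambda>h. kl (emp_loss n f h xs) (exp_loss M f h)"
    have [measurable]: "(\<lambda>h. emp_loss n f h xs) \<in> borel_measurable borel"
    proof -
      have "(\<lambda>h. (\<lambda>(h, xs). emp_loss n f h xs) (h, xs)) \<in> borel_measurable lborel" using xs by measurable
      then show ?thesis by simp
    qed
    \<comment> \<open>The tangent of exp at b, as z + 1 <= b + exp (z - b) with z = (n/2) kl.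
      Integrated over h it takes the place of Jensen's inequality, and it remains valid where kl is
      infinite.\<close>
    have tangent: "ennreal (real n / 2) * e2ennreal (?kl h) + 1
      \<le> ennreal b + ennreal (exp (- b)) * eexp (ereal (real n / 2) * ?kl h)" for h
    proof -
      have "0 \<le> ?kl h" by (intro kl_nonneg emp_loss_range[OF xs] exp_loss_range)
      then consider y where "?kl h = ereal y" "0 \<le> y" | "?kl h = \<infinity>" by (cases "?kl h") auto
      then show ?thesis
      proof cases
        case 1
        have "ennreal (real n / 2) * e2ennreal (?kl h) + 1 = ennreal (real n / 2 * y + 1)"
          using 1 by (simp add: ennreal_mult' [symmetric] ennreal_plus e2ennreal_ereal)
        also have "\<dots> \<le> ennreal (b + exp (- b + real n / 2 * y))"
          using exp_ge_add_one_self[of "- b + real n / 2 * y"] by (intro ennreal_leI) linarith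
        also have "\<dots> = ennreal b + ennreal (exp (- b)) * eexp (ereal (real n / 2) * ?kl h)"
          using 1 b0 by (simp only: ennreal_plus exp_add ennreal_mult' exp_ge_zero mult_nonneg_nonneg) (simp add: eexp_def)
        finally show ?thesis .
      next
        case 2
        then show ?thesis using n0 by (simp add: eexp_def ennreal_mult_top)
      qed
    qed
    have "ennreal (real n / 2) * (\<integral>\<^sup>+ h. e2ennreal (?kl h) \<partial>Q xs) + 1
      = (\<integral>\<^sup>+ h. ennreal (real n / 2) * e2ennreal (?kl h) + 1 \<partial>Q xs)"
      using Q.emeasure_space_1 by (simp add: nn_integral_add nn_integral_cmult)
    also have "\<dots> \<le> (\<integral>\<^sup>+ h. ennreal b + ennreal (exp (- b)) * eexp (ereal (real n / 2) * ?kl h) \<partial>Q xs)"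
      by (intro nn_integral_mono tangent)
    also have "\<dots> = ennreal b + ennreal (exp (- b)) * kl_moment xs"
      using Q.emeasure_space_1 by (simp add: nn_integral_add nn_integral_cmult kl_moment_def)
    also have "\<dots> \<le> ennreal b + 1" by (intro add_left_mono le)
    finally have "ennreal (real n / 2) * (\<integral>\<^sup>+ h. e2ennreal (?kl h) \<partial>Q xs) \<le> ennreal b"
      by (simp add: ennreal_add_left_cancel_le add.commute)
    then have "ennreal (2 / real n) * (ennreal (real n / 2) * (\<integral>\<^sup>+ h. e2ennreal (?kl h) \<partial>Q xs)) \<le> ennreal (2 / real n) * ennreal b"
      by (rule mult_left_mono) simp
    then have "(\<integral>\<^sup>+ h. e2ennreal (?kl h) \<partial>Q xs) \<le> ennreal (2 / real n * b)"
      using n0 b0 by (simp add: mult.assoc [symmetric] ennreal_mult' [symmetric])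
    also have "2 / real n * b = (6 / \<sigma>\<^sup>2 * V + ln (2 * sqrt (real n)) + 2 * ln (1 / \<delta>)) / real n"
      unfolding b_def C_def by (simp add: add_divide_distrib distrib_left)
    finally show ?thesis using xs by simp
  qed
  have "1 = (\<integral>\<^sup>+ xs. 1 \<partial>sample_space M n)" by (simp add: P.emeasure_space_1)
  also have "\<dots> \<le> (\<integral>\<^sup>+ xs. indicator ?S xs + ennreal (exp (- b)) * kl_moment xs \<partial>sample_space M n)"
  proof (intro nn_integral_mono)
    fix xs assume xs: "xs \<in> space (sample_space M n)"
    show "1 \<le> indicator ?S xs + ennreal (exp (- b)) * kl_moment xs"
    proof (cases "xs \<in> ?S")
      case True
      then have "indicator ?S xs = (1 :: ennreal)" by (rule indicator_simps)
      then show ?thesis by simp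
    next
      case False
      with in_S[OF xs] have "1 \<le> ennreal (exp (- b)) * kl_moment xs"
        using linear by blast
      then show ?thesis by (rule order.trans) simp
    qed
  qed
  also have "\<dots> = emeasure (sample_space M n) ?S + ennreal (exp (- b)) * (\<integral>\<^sup>+ xs. kl_moment xs \<partial>sample_space M n)"
    by (subst nn_integral_add) (auto simp: nn_integral_cmult)
  also have "\<dots> \<le> emeasure (sample_space M n) ?S + ennreal (exp (- b)) * ennreal (exp C)"
    unfolding C_def by (intro add_left_mono mult_left_mono kl_moment_bound n8) simp
  also have "ennreal (exp (- b)) * ennreal (exp C) = ennreal \<delta>"
    using \<delta> by (simp add: ennreal_mult' [symmetric] exp_add [symmetric] b_def ln_div)
  finally show "1 \<le> emeasure (sample_space M n) ?S + ennreal \<delta>" .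
qed (use \<delta> in simp)

end

theorem theorem9:
  fixes M :: "'x measure" and n :: nat
    and f :: "'h::euclidean_space \<Rightarrow> 'x \<Rightarrow> real"
    and A :: "(nat \<Rightarrow> 'x) \<Rightarrow> 'h"
    and \<sigma> \<delta> :: real
  assumes M: "prob_space M"
    and n: "n \<ge> 1"
    and f_meas: "(\<lambda>(h, x). f h x) \<in> borel_measurable (lborel \<Otimes>\<^sub>M M)"
    and f_range: "\<And>h x. x \<in> space M \<Longrightarrow> 0 \<le> f h x \<and> f h x \<le> 1"
    and A_meas: "A \<in> borel_measurable (sample_space M n)"
    and \<sigma>: "\<sigma> > 0"
    and sens: "ereal (12 * real n) * (hyp_sens M n A)\<^sup>2 \<le> ereal (\<sigma>\<^sup>2)"
    and \<delta>: "\<delta> > 0"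
  defines "Q \<equiv> gibbs (\<lambda>h xs. - (norm (h - A xs))\<^sup>2 / (2 * \<sigma>\<^sup>2))"
    and "V \<equiv> var_alg M n A"
  shows
   "(n > 8 \<longrightarrow>
      (let E = (\<integral>\<^sup>+ xs. (\<integral>\<^sup>+ h. eexp (ereal (real n / 2) * kl (emp_loss n f h xs) (exp_loss M f h)) \<partial>Q xs)
                 \<partial>sample_space M n)
       in E \<noteq> \<infinity> \<and> ln (enn2real E) \<le> 3 / \<sigma>\<^sup>2 * V + ln (2 * sqrt (real n)) / 2))
  \<and> (n > 8 \<longrightarrow>
      emeasure (sample_space M n)
        {xs \<in> space (sample_space M n).
           (\<integral>\<^sup>+ h. e2ennreal (kl (emp_loss n f h xs) (exp_loss M f h)) \<partial>Q xs)
             \<le> ennreal ((6 / \<sigma>\<^sup>2 * V + ln (2 * sqrt (real n)) + 2 * ln (1 / \<delta>)) / real n)}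
        \<ge> ennreal (1 - \<delta>))
  \<and> (\<integral>\<^sup>+ xs. emeasure (Q xs)
        {h \<in> space (Q xs). gen_gap M n f h xs \<le> sqrt ((3 / \<sigma>\<^sup>2 * V + ln (1 / \<delta>)) / real n)}
      \<partial>sample_space M n) \<ge> ennreal (1 - \<delta>)
  \<and> (\<integral>\<^sup>+ xs. emeasure (Q xs)
        {h \<in> space (Q xs). gen_gap M n f h xs \<le>
            2 * sqrt (var_h M f h * ((3 / \<sigma>\<^sup>2 * V + ln (1 / \<delta>)) / real n))
            + (3 / \<sigma>\<^sup>2 * V + ln (1 / \<delta>)) / real n}
      \<partial>sample_space M n) \<ge> ennreal (1 - \<delta>)"
  (is "(_ \<longrightarrow> ?i) \<and> (_ \<longrightarrow> ?ii) \<and> ?iii \<and> ?iv")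
proof -
  interpret R: gauss_randomization M n f A \<sigma>
    using assms by (intro gauss_randomization.intro gauss_randomization_axioms.intro) auto
  have Q: "Q = R.Q" unfolding Q_def R.Q_def ..
  have i: ?i if n8: "n > 8"
  proof -
    define E where "E = (\<integral>\<^sup>+ xs. R.kl_moment xs \<partial>sample_space M n)"
    define b where "b = 3 / \<sigma>\<^sup>2 * V + ln (2 * sqrt (real n)) / 2"
    have E_le: "E \<le> ennreal (exp b)"
      unfolding E_def b_def V_def by (rule R.kl_moment_bound[OF n8])
    then have "E \<noteq> \<infinity>" by (auto simp: top_unique)
    moreover have "ln (enn2real E) \<le> b"
    proof (cases "enn2real E = 0")
      \<comment> \<open>Here \<open>ln 0 = 0\<close>, so the claim becomes b >= 0.\<close>
      case True
      have "sqrt (real n) \<ge> 1" using n by simp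
      then have "2 * sqrt (real n) \<ge> 1" by linarith
      then have "b \<ge> 0"
        unfolding b_def V_def using R.var_alg_nonneg by (intro add_nonneg_nonneg) auto
      with True show ?thesis by simp
    next
      case False
      then have "enn2real E > 0" using enn2real_nonneg[of E] by linarith
      moreover have "enn2real E \<le> exp b"
        using E_le by (intro enn2real_leI) auto
      ultimately show ?thesis by (metis ln_exp ln_le_cancel_iff exp_gt_zero)
    qed
    ultimately show ?thesis unfolding E_def R.kl_moment_def Q Let_def b_def by simp
  qed
  have ii: ?ii if "n > 8"
    \<comment> \<open>For \<delta> >= 1 the lower bound \<open>ennreal (1 - \<delta>)\<close> is 0;
      likewise in (iii) and (iv).\<close>
    using R.kl_deviation[OF that \<delta>] by (cases "\<delta> < 1") (auto simp: Q V_def ennreal_neg)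
  have iii: ?iii
    using R.hoeffding_deviation[OF \<delta>] by (cases "\<delta> < 1") (auto simp: Q V_def ennreal_neg)
  have iv: ?iv
    using R.bernstein_deviation[OF \<delta>] by (cases "\<delta> < 1") (auto simp: Q V_def ennreal_neg)
  show ?thesis by (intro conjI impI i ii iii iv)
qed

end
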